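(* Fix an integer $k\ge1$. Let $q\in[1,k]$ and $j\in[1,q]$ be integers with $\gcd(j,q)=1$, and let $f,m,M,s,t,\eta,c$ be as defined in the context. Then for each $w\in[1,f]$, $c(0)\to c(1)\to\cdots\to c(q)=c(0)$ is a cycle of $G(\eta(q,j),k)$, and these $f$ cycles (for $w=1,\dots,f$) are distinct cycles of length $q$; consequently $N(\eta(q,j),k)=f$ and $\eta(q,j)$ is a local peak. Moreover, the local peaks are exactly the integers $\eta(q,j)$ with $1\le q\le k$, $1\le j\le q$, $\gcd(j,q)=1$; i.e. the set of points $(n,N(n,k))$ with $n$ a local peak is exactly $\{(\eta(q,j),\lfloor k/q\rfloor): 1\le q\le k,\ 1\le j\le q,\ \gcd(j,q)=1\}$.
   Context: For integers $\ell$ and $p\ge1$, $(\ell)_p$ (also $\ell_p$) denotes the least nonnegative residue of $\ell$ modulo $p$. $G(n,k)$ is the directed graph on vertices $0,\dots,k$ with exactly the $k$ edges $(i+n-2)_{k+1}\to(i+n-1)_k$, $1\le i\le k$ (a loop $a\to a$ counts as a cycle of length $1$). For $n>k$, $N(n,k)$ is the nullity of the $n\times n$ skew-symmetric Toeplitz matrix $A(n,k)$ whose first $k$ superdiagonals are all $1$ and remaining superdiagonals all $0$; this nullity depends only on $n \bmod (k^2+k)$, and $N(n,k)$ is defined for every integer $n$ as $N(n',k)$ for any $n'>k$ with $n'\equiv n\pmod{k^2+k}$. An integer $n$ with $0<n<k^2+k$ is a local peak if $N(n-1,k)<N(n,k)$ and $N(n+1,k)<N(n,k)$. Notation: $f=\lfloor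 k/q\rfloor$, $m=k-fq$, $M=m+1$; $s(q,j)=|\{a\in[1,m]:(aj)_q\le(Mj)_q\}|$; for $r\in[1,q-1]$, $t(r,q,j)=|\{a\in[0,m]:(aj)_q<(rj)_q\}|$; $\eta(q,j)=k\lfloor (k+1)j/q\rfloor-k+(Mj)_q f+s(q,j)$; for $w\in[1,f]$, $c(r)=-1-w+(rj)_q f+t(r,q,j)$ for $1\le r\le q-1$ and $c(0)=c(q)=k-w$. *)

theory Defs
  imports Main "Jordan_Normal_Form.Matrix_Kernel"
begin

definition G_verts :: "int \<Rightarrow> int set" where
  "G_verts k = {0..k}"

definition G_edges :: "int \<Rightarrow> int \<Rightarrow> (int \<times> int) set" where
  "G_edges n k = {((i + n - 2) mod (k + 1), (i + n - 1) mod k) | i. 1 \<le> i \<and> i \<le> k}"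

definition is_cycle :: "(int \<times> int) set \<Rightarrow> (int \<Rightarrow> int) \<Rightarrow> int \<Rightarrow> bool" where
  "is_cycle E c len \<longleftrightarrow> 1 \<le> len \<and> c len = c 0 \<and>
     (\<forall>r \<in> {0..<len}. (c r, c (r + 1)) \<in> E) \<and> inj_on c {0..<len}"

definition cycle_verts :: "(int \<Rightarrow> int) \<Rightarrow> int \<Rightarrow> int set" where
  "cycle_verts c len = c ` {0..<len}"

definition A_mat :: "nat \<Rightarrow> nat \<Rightarrow> real mat" where
  "A_mat n k = mat n n (\<lambda>(a, b).
      if b > a \<and> b - a \<le> k then 1
      else if a > b \<and> a - b \<le> k then -1 else 0)"

definition nullity :: "nat \<Rightarrow> nat \<Rightarrow> nat" where
  "nullity n k = kernel_dim (A_mat n k)"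

text \<open>N(n,k) for every integer n, via the representative n' = (n mod (k^2+k)) + (k^2+k) > k.\<close>
definition N :: "int \<Rightarrow> int \<Rightarrow> nat" where
  "N n k = nullity (nat (n mod (k^2 + k) + (k^2 + k))) (nat k)"

definition local_peak :: "int \<Rightarrow> int \<Rightarrow> bool" where
  "local_peak n k \<longleftrightarrow> 0 < n \<and> n < k^2 + k \<and> N (n - 1) k < N n k \<and> N (n + 1) k < N n k"

definition fq :: "int \<Rightarrow> int \<Rightarrow> int" where "fq k q = k div q"
definition mq :: "int \<Rightarrow> int \<Rightarrow> int" where "mq k q = k - fq k q * q"
definition Mq :: "int \<Rightarrow> int \<Rightarrow> int" where "Mq k q = mq k q + 1"

definition s_fun :: "int \<Rightarrow> int \<Rightarrow> int \<Rightarrow> int" where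
  "s_fun k q j = int (card {a \<in> {1..mq k q}. (a * j) mod q \<le> (Mq k q * j) mod q})"

definition t_fun :: "int \<Rightarrow> int \<Rightarrow> int \<Rightarrow> int \<Rightarrow> int" where
  "t_fun k r q j = int (card {a \<in> {0..mq k q}. (a * j) mod q < (r * j) mod q})"

definition eta :: "int \<Rightarrow> int \<Rightarrow> int \<Rightarrow> int" where
  "eta k q j = k * (((k + 1) * j) div q) - k + ((Mq k q * j) mod q) * fq k q + s_fun k q j"

definition c_fun :: "int \<Rightarrow> int \<Rightarrow> int \<Rightarrow> int \<Rightarrow> int \<Rightarrow> int" where
  "c_fun k q j w r = (if r = 0 \<or> r = q then k - w
      else -1 - w + ((r * j) mod q) * fq k q + t_fun k r q j)"

end

theory Submission
  imports Defs
begin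

text \<open>
  The partial sums of a kernel vector of \<open>A(n,k)\<close> satisfy a linear recurrence with characteristic
  polynomial \<open>(z ^ k - 1) (z ^ (k + 1) - 1)\<close>, and the boundary conditions identify the kernel with the
  functions on the vertices of \<open>G(n,k)\<close> that vanish at \<open>k\<close> and are constant along edges.
  Since \<open>G(n,k)\<close> is a path starting at \<open>k\<close> together with cycles, the nullity is the number of cycles.

  For \<open>n = eta(q,j)\<close> the vertices are listed explicitly: \<open>f\<close> cycles of length \<open>q\<close> and a path with
  \<open>m + 1\<close> vertices, on which the graph acts like the rotation by \<open>j\<close> on \<open>q\<close> arcs. Replacing \<open>n\<close> by
  \<open>n + 1\<close> or \<open>n - 1\<close> moves a single edge and splices the cycle next to the end of the path into the
  path. Hence \<open>N(eta(q,j) + d, k) = f - \<bar>d\<bar>\<close> for \<open>\<bar>d\<bar> \<le> f\<close>: each \<open>eta(q,j)\<close> is the summit of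
  a mountain of height and half-width \<open>f\<close>. Distinct mountains do not overlap, and their widths add
  up to the sum of \<open>2 \<phi>(q) \<lfloor>k / q\<rfloor>\<close> over \<open>q \<le> k\<close>, which is the period \<open>k\<^sup>2 + k\<close>. So they
  cover all residues and there is no other peak.
\<close>

section \<open>The kernel of the Toeplitz matrix\<close>

text \<open>Applying \<open>\<phi> i\<close> to a combination reads off the coefficient of
  \<open>b i\<close>, so the \<open>b i\<close> are independent. They span because subtracting from
  a kernel vector \<open>v\<close> the combination whose coefficients are the values of the
  functionals at \<open>v\<close> leaves a kernel vector on which all functionals vanish.\<close>

lemma kernel_dim_eq_card_dual:
  fixes A :: "'a :: field mat"
  assumes A: "A \<in> carrier_mat nr nc" and I: "finite I"
    and b: "\<And>i. i \<in> I \<Longrightarrow> b i \<in> mat_kernel A"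
    and dual: "\<And>i j. i \<in> I \<Longrightarrow> j \<in> I \<Longrightarrow>
      (\<Sum>l<nc. \<phi> i l * b j $ l) = (if i = j then 1 else 0)"
    and sep: "\<And>x. x \<in> mat_kernel A \<Longrightarrow> (\<And>i. i \<in> I \<Longrightarrow> (\<Sum>l<nc. \<phi> i l * x $ l) = 0) \<Longrightarrow>
      x = 0\<^sub>v nc"
  shows "kernel_dim A = card I"
proof -
  interpret kernel nr nc A by (unfold_locales, rule A)
  have inj: "inj_on b I"
  proof (rule inj_onI)
    fix i j assume "i \<in> I" "j \<in> I" "b i = b j"
    with dual[of i i] dual[of i j] show "i = j" by (auto split: if_splits)
  qed
  let ?B = "b ` I"
  have sub: "?B \<subseteq> mat_kernel A" using b by auto
  have fin: "finite ?B" using I by auto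
  have coord: "(\<Sum>l<nc. \<phi> i l * lincomb a ?B $ l) = a (b i)" if "i \<in> I" for a i
  proof -
    have "(\<Sum>l<nc. \<phi> i l * lincomb a ?B $ l) = (\<Sum>l<nc. \<phi> i l * (\<Sum>j\<in>I. a (b j) * b j $ l))"
      by (intro sum.cong refl) (simp add: lincomb_index[OF _ sub] sum.reindex[OF inj])
    also have "\<dots> = (\<Sum>j\<in>I. a (b j) * (\<Sum>l<nc. \<phi> i l * b j $ l))"
      unfolding sum_distrib_left by (subst sum.swap) (simp add: mult.left_commute)
    also have "\<dots> = (\<Sum>j\<in>I. if j = i then a (b j) else 0)"
      using dual that by (intro sum.cong refl) auto
    also have "\<dots> = a (b i)" using I that by simp
    finally show ?thesis .
  qed
  have "basis ?B"
    unfolding Ker.basis_def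
  proof (intro conjI)
    show "span ?B = mat_kernel A"
    proof
      show "span ?B \<subseteq> mat_kernel A" using sub by (rule Ker.span_is_subset2)
      show "mat_kernel A \<subseteq> span ?B"
      proof
        fix v assume v: "v \<in> mat_kernel A"
        have vc: "v \<in> carrier_vec nc" using mat_kernelD[OF A v] by simp
        define a where "a = (\<lambda>y. \<Sum>l<nc. \<phi> (the_inv_into I b y) l * v $ l)"
        have ab: "a (b i) = (\<Sum>l<nc. \<phi> i l * v $ l)" if "i \<in> I" for i
          unfolding a_def using that by (simp add: the_inv_into_f_f[OF inj])
        let ?u = "lincomb a ?B"
        have uk: "?u \<in> mat_kernel A" using Ker.lincomb_closed[OF sub] by auto
        have uc: "?u \<in> carrier_vec nc" using mat_kernelD[OF A uk] by simp
        have "v - ?u \<in> mat_kernel A"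
          using mat_kernelD[OF A v] mat_kernelD[OF A uk] A
          by (intro mat_kernelI[OF A]) (auto simp: mult_minus_distrib_mat_vec)
        moreover have "(\<Sum>l<nc. \<phi> i l * (v - ?u) $ l) = 0" if "i \<in> I" for i
        proof -
          have "(\<Sum>l<nc. \<phi> i l * (v - ?u) $ l) = (\<Sum>l<nc. \<phi> i l * v $ l - \<phi> i l * ?u $ l)"
            using uc vc by (intro sum.cong refl) (auto simp: algebra_simps)
          also have "\<dots> = 0" unfolding sum_subtractf coord[OF that] ab[OF that] by simp
          finally show ?thesis .
        qed
        ultimately have d: "v - ?u = 0\<^sub>v nc" by (rule sep)
        have "v = ?u"
        proof (rule eq_vecI)
          fix l assume "l < dim_vec ?u"
          with uc have l: "l < nc" by auto
          have "(v - ?u) $ l = 0" using d l by simp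
          thus "v $ l = ?u $ l" using l uc vc by simp
        qed (use uc vc in auto)
        thus "v \<in> span ?B" unfolding Ker.span_def using fin by auto
      qed
    qed
    show "?B \<subseteq> mat_kernel A" by (rule sub)
    have "a y = 0" if lc: "lincomb a ?B = 0\<^sub>v nc" and y: "y \<in> ?B" for a y
    proof -
      obtain i where i: "i \<in> I" "y = b i" using y by auto
      show ?thesis using coord[OF i(1), of a] unfolding lc i(2) by simp
    qed
    thus "\<not> lin_dep ?B"
      by (intro Ker.finite_lin_indpt2[OF fin sub], auto simp: class_field_def)
  qed
  from Ker.dim_basis[OF fin this] show ?thesis by (simp add: card_image[OF inj])
qed

section \<open>Partial sums of kernel vectors\<close>

text \<open>The argument runs over all integers: the value is 0 to the left of the vector and
  constant from its last index on, so the rows near the border of the matrix need no separate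
  treatment.\<close>

definition psum :: "real vec \<Rightarrow> int \<Rightarrow> real" where
  "psum x c = (\<Sum>l<dim_vec x. (if int l \<le> c then 1 else 0) * x $ l)"

lemma A_mat_carrier: "A_mat n k \<in> carrier_mat n n"
  unfolding A_mat_def by simp

text \<open>Row \<open>a\<close> adds the entries \<open>a + 1\<close> to \<open>a + k\<close> and
  subtracts the entries \<open>a - k\<close> to \<open>a - 1\<close>; each block is a difference of
  two partial sums.\<close>

lemma mat_kernel_A_mat_iff:
  assumes "x \<in> carrier_vec n"
  shows "x \<in> mat_kernel (A_mat n k) \<longleftrightarrow> (\<forall>a. 0 \<le> a \<and> a < int n \<longrightarrow>
    psum x (a + int k) + psum x (a - int k - 1) = psum x a + psum x (a - 1))"
proof -
  have row: "(A_mat n k *\<^sub>v x) $ a = psum x (int a + int k) + psum x (int a - int k - 1) -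
      (psum x (int a) + psum x (int a - 1))" if a: "a < n" for a
  proof -
    have "(A_mat n k *\<^sub>v x) $ a = (\<Sum>l<n. A_mat n k $$ (a, l) * x $ l)"
      using a assms A_mat_carrier[of n k]
      by (simp add: scalar_prod_def atLeast0LessThan)
    also have "\<dots> = (\<Sum>l<n. (if int l \<le> int a + int k then 1 else 0) * x $ l
       + (if int l \<le> int a - int k - 1 then 1 else 0) * x $ l
       - ((if int l \<le> int a then 1 else 0) * x $ l + (if int l \<le> int a - 1 then 1 else 0) * x $ l))"
      using a by (intro sum.cong refl) (auto simp: A_mat_def)
    also have "\<dots> = psum x (int a + int k) + psum x (int a - int k - 1) -
      (psum x (int a) + psum x (int a - 1))"
      using assms unfolding psum_def sum_subtractf sum.distrib by simp
    finally show ?thesis .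
  qed
  have "x \<in> mat_kernel (A_mat n k) \<longleftrightarrow> (\<forall>a<n. (A_mat n k *\<^sub>v x) $ a = 0)"
  proof -
    have "A_mat n k *\<^sub>v x = 0\<^sub>v n \<longleftrightarrow> (\<forall>a<n. (A_mat n k *\<^sub>v x) $ a = 0)"
    proof
      assume "\<forall>a<n. (A_mat n k *\<^sub>v x) $ a = 0"
      thus "A_mat n k *\<^sub>v x = 0\<^sub>v n"
        using A_mat_carrier[of n k] by (intro eq_vecI) (auto simp del: index_mult_mat_vec)
    qed (simp del: index_mult_mat_vec)
    thus ?thesis unfolding mat_kernel[OF A_mat_carrier] using assms by blast
  qed
  also have "\<dots> \<longleftrightarrow> (\<forall>a<n. psum x (int a + int k) + psum x (int a - int k - 1) =
      psum x (int a) + psum x (int a - 1))"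
    using row by auto
  also have "\<dots> \<longleftrightarrow> (\<forall>a. 0 \<le> a \<and> a < int n \<longrightarrow>
    psum x (a + int k) + psum x (a - int k - 1) = psum x a + psum x (a - 1))"
    by (metis nonneg_int_cases of_nat_0_le_iff of_nat_less_iff)
  finally show ?thesis .
qed

lemma psum_neg: "c < 0 \<Longrightarrow> psum x c = 0"
  unfolding psum_def by (intro sum.neutral) auto

lemma psum_ge:
  assumes "c \<ge> int (dim_vec x) - 1" "d \<ge> int (dim_vec x) - 1"
  shows "psum x c = psum x d"
  unfolding psum_def using assms by (intro sum.cong) auto

lemma psum_step:
  assumes "l < dim_vec x"
  shows "psum x (int l) - psum x (int l - 1) = x $ l"
proof -
  have "psum x (int l) - psum x (int l - 1) = (\<Sum>i<dim_vec x. if i = l then x $ l else 0)"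
    unfolding psum_def sum_subtractf[symmetric] by (intro sum.cong) auto
  also have "\<dots> = x $ l" using assms by simp
  finally show ?thesis .
qed

lemma int_residue_induct [consumes 1, case_names base step]:
  fixes P :: "int \<Rightarrow> bool"
  assumes "a \<le> b" "\<And>b. a \<le> b \<Longrightarrow> b < a + p \<Longrightarrow> P b"
    "\<And>b. a + p \<le> b \<Longrightarrow> P (b - p) \<Longrightarrow> P b" "p > 0"
  shows "P b"
  using assms(1)
proof (induction "nat (b - a)" arbitrary: b rule: less_induct)
  case less
  show ?case
  proof (cases "b < a + p")
    case True thus ?thesis using less assms(2) by auto
  next
    case False thus ?thesis using less(1)[of "b - p"] assms(3)[of b] assms(4) by auto
  qed
qed

section \<open>Solutions of the recurrence as functions on the vertices\<close>

context
  fixes X u :: "int \<Rightarrow> real" and k n :: int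
  assumes k: "k \<ge> 1" and n: "n \<ge> 1"
    and X_neg: "\<And>c. c < 0 \<Longrightarrow> X c = 0"
    and u_X: "\<And>c. 0 \<le> c \<Longrightarrow> c < k \<Longrightarrow> u c = X c"
    and u_k: "u k = 0"
    and rec: "\<And>a. 0 \<le> a \<Longrightarrow> a < n \<Longrightarrow> X (a + k) + X (a - k - 1) = X a + X (a - 1)"
begin

text \<open>The recurrence says that \<open>X (b + k) - X b\<close> is unchanged when
  \<open>b\<close> drops by \<open>k + 1\<close>. On the first window \<open>X b = 0\<close>, which
  leaves the initial values of \<open>X\<close>; the value \<open>u k = 0\<close> stands for
  \<open>X (- 1) - X (- k - 1)\<close>.\<close>

lemma diff_k_periodic:
  assumes "- k - 1 \<le> b" "b < n"
  shows "X (b + k) - X b = u ((b + k) mod (k + 1))"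
  using assms
proof (induction b rule: int_residue_induct[where p = "k + 1"])
  case (base b)
  show ?case
  proof (cases "b = - k - 1")
    case True
    hence "(b + k) mod (k + 1) = k" using k by (simp add: zmod_minus1)
    thus ?thesis using True X_neg k u_k by simp
  next
    case False
    hence "(b + k) mod (k + 1) = b + k" using base k by (intro mod_pos_pos_trivial) auto
    thus ?thesis using False base k by (simp add: X_neg u_X)
  qed
next
  case (step b)
  have "X (b + k) - X b = X (b - (k + 1) + k) - X (b - (k + 1))"
    using rec[of b] step by (simp add: algebra_simps)
  also have "\<dots> = u ((b - (k + 1) + k) mod (k + 1))" using step k by simp
  also have "(b - (k + 1) + k) mod (k + 1) = (b + k) mod (k + 1)"
    using minus_mod_self2[of "b + k" "k + 1"] by (simp add: algebra_simps)
  finally show ?case .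
qed (use k in auto)

text \<open>The same recurrence, grouped the other way, gives period \<open>k\<close> for the
  differences at distance \<open>k + 1\<close>.\<close>

lemma diff_Suc_k_periodic:
  assumes "- k - 1 \<le> b" "b < n - 1"
  shows "X (b + k + 1) - X b = u ((b + k + 1) mod k)"
  using assms
proof (induction b rule: int_residue_induct[where p = k])
  case (base b)
  hence "(b + k + 1) mod k = b + k + 1" using k by (intro mod_pos_pos_trivial) auto
  thus ?case using base k by (simp add: X_neg u_X)
next
  case (step b)
  have "X (b + k + 1) - X b = X (b - k + k + 1) - X (b - k)"
    using rec[of "b + 1"] step by (simp add: algebra_simps)
  also have "\<dots> = u ((b - k + k + 1) mod k)" using step k by simp
  also have "(b - k + k + 1) mod k = (b + k + 1) mod k"
    using mod_add_self2[of "b + 1" k] by (simp add: algebra_simps)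
  finally show ?case .
qed (use k in auto)

text \<open>Subtracting the two periodicity statements at the same \<open>b\<close> cancels
  \<open>X b\<close>: consecutive values of \<open>X\<close> past the end differ exactly as
  \<open>u\<close> differs along an edge.\<close>

lemma eventually_const_iff_edges:
  "(\<forall>c. n \<le> c \<and> c < n + k \<longrightarrow> X c = X (c - 1)) \<longleftrightarrow> (\<forall>(x, y) \<in> G_edges n k. u x = u y)"
proof -
  have *: "u ((i + n - 2) mod (k + 1)) - u ((i + n - 1) mod k) = X (n + i - 2) - X (n + i - 1)"
    if "1 \<le> i" "i \<le> k" for i
    using diff_k_periodic[of "n + i - 2 - k"] diff_Suc_k_periodic[of "n + i - 2 - k"] that n
    by (simp add: algebra_simps)
  have "(\<forall>c. n \<le> c \<and> c < n + k \<longrightarrow> X c = X (c - 1)) \<longleftrightarrow>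
    (\<forall>i. 1 \<le> i \<and> i \<le> k \<longrightarrow> X (n + i - 2) - X (n + i - 1) = 0)" (is "?l = ?r")
  proof
    assume ?l
    show ?r
    proof (intro allI impI)
      fix i assume "1 \<le> i \<and> i \<le> k"
      with \<open>?l\<close>[rule_format, of "n + i - 1"] show "X (n + i - 2) - X (n + i - 1) = 0" by simp
    qed
  next
    assume ?r
    show ?l
    proof (intro allI impI)
      fix c assume "n \<le> c \<and> c < n + k"
      with \<open>?r\<close>[rule_format, of "c - n + 1"] show "X c = X (c - 1)" by simp
    qed
  qed
  also have "\<dots> \<longleftrightarrow> (\<forall>(x, y) \<in> G_edges n k. u x = u y)"
    using * unfolding G_edges_def by force
  finally show ?thesis .
qed

lemma zero_if_initially_zero:
  assumes "\<And>c. 0 \<le> c \<Longrightarrow> c < k \<Longrightarrow> X c = 0" "c < n + k"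
  shows "X c = 0"
proof (cases "c < 0")
  case False
  hence "0 \<le> c" by simp
  thus ?thesis using assms(2)
  proof (induction c rule: int_residue_induct[where p = k])
    case (base c) thus ?case using assms(1) by simp
  next
    case (step c)
    have "c mod (k + 1) \<le> k" "0 \<le> c mod (k + 1)" 
      using k pos_mod_bound[of "k + 1" c] by auto
    hence "u (c mod (k + 1)) = 0"
      using u_k u_X assms(1) by (cases "c mod (k + 1) = k") auto
    thus ?case using diff_k_periodic[of "c - k"] step k by simp
  qed (use k in auto)
qed (use X_neg in auto)

end

text \<open>The extension of initial data \<open>u\<close> by
  \<open>X c = X (c - k) + u (c mod (k + 1))\<close>. For negative \<open>c\<close> the sum is empty
  because \<open>nat\<close> truncates.\<close>

definition unfold_seq :: "int \<Rightarrow> (int \<Rightarrow> real) \<Rightarrow> int \<Rightarrow> real" where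
  "unfold_seq k u c = (\<Sum>i<nat (c div k + 1). u ((c - int i * k) mod (k + 1)))"

lemma unfold_seq_neg: "k \<ge> 1 \<Longrightarrow> c < 0 \<Longrightarrow> unfold_seq k u c = 0"
  unfolding unfold_seq_def using div_neg_pos_less0[of c k] by simp

lemma unfold_seq_step:
  assumes "k \<ge> 1" "c \<ge> 0"
  shows "unfold_seq k u c = unfold_seq k u (c - k) + u (c mod (k + 1))"
proof -
  have "(c - k) div k = c div k - 1" 
    using assms div_add_self2[of k "c - k"] by simp
  moreover have "c div k \<ge> 0" using assms by (simp add: pos_imp_zdiv_nonneg_iff)
  ultimately have "nat (c div k + 1) = Suc (nat ((c - k) div k + 1))" by simp
  thus ?thesis unfolding unfold_seq_def
    by (simp add: sum.lessThan_Suc_shift algebra_simps del: sum.lessThan_Suc)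
qed

text \<open>The increments ending at \<open>a + k\<close> and at \<open>a - 1\<close> agree, since
  these arguments are congruent modulo \<open>k + 1\<close>. For \<open>a = 0\<close> the second
  increment is missing, and \<open>u k = 0\<close> makes up for it.\<close>

lemma unfold_seq_rec:
  assumes k: "k \<ge> 1" and u: "u k = 0" and a: "a \<ge> 0"
  shows "unfold_seq k u (a + k) + unfold_seq k u (a - k - 1)
    = unfold_seq k u a + unfold_seq k u (a - 1)"
proof -
  have "unfold_seq k u (a - 1) = unfold_seq k u (a - k - 1) + u ((a + k) mod (k + 1))"
  proof (cases "a = 0")
    case True
    have "k mod (k + 1) = k" using k by (intro mod_pos_pos_trivial) auto
    thus ?thesis using True k u by (simp add: unfold_seq_neg)
  next
    case False
    have "(a + k) mod (k + 1) = (a - 1) mod (k + 1)"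
      using mod_add_self2[of "a - 1" "k + 1"] by (simp add: algebra_simps)
    thus ?thesis using unfold_seq_step[of k "a - 1" u] False k a by (simp add: algebra_simps)
  qed
  thus ?thesis using unfold_seq_step[of k "a + k" u] k a by simp
qed

text \<open>The nullity counts the functions on the vertices that vanish at \<open>k\<close> and are constant along
  edges: such a function records the first \<open>k\<close> partial sums of a kernel vector. The labelling
  \<open>h\<close> distinguishes the components, and \<open>k - w\<close> is a chosen vertex of component \<open>w\<close>.\<close>
lemma nullity_eq_card_components:
  fixes k :: int and n :: nat
  assumes k: "k \<ge> 1" and n: "n \<ge> 1" and L: "L \<subseteq> {1..k}"
    and h_edge: "\<And>x y. (x, y) \<in> G_edges (int n) k \<Longrightarrow> h x = h y"
    and h_k: "h k \<notin> L" and h_L: "\<And>w. w \<in> L \<Longrightarrow> h (k - w) = w"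
    and sep: "\<And>u :: int \<Rightarrow> real. u k = 0 \<Longrightarrow> (\<And>x y. (x, y) \<in> G_edges (int n) k \<Longrightarrow> u x = u y) \<Longrightarrow>
       (\<And>w. w \<in> L \<Longrightarrow> u (k - w) = 0) \<Longrightarrow> (\<And>x. 0 \<le> x \<Longrightarrow> x < k \<Longrightarrow> u x = 0)"
  shows "nullity n (nat k) = card L"
  unfolding nullity_def
proof (rule kernel_dim_eq_card_dual[OF A_mat_carrier, where \<phi> = "\<lambda>w l. if int l \<le> k - w then 1 else 0"])
  show "finite L" using L by (rule finite_subset) simp
next
  fix x assume x: "x \<in> mat_kernel (A_mat n (nat k))"
    and z: "\<And>w. w \<in> L \<Longrightarrow> (\<Sum>l<n. (if int l \<le> k - w then 1 else 0) * x $ l) = 0"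
  have xc: "x \<in> carrier_vec n" using mat_kernelD[OF A_mat_carrier x] by simp
  have dx: "dim_vec x = n" using xc by simp
  define u where "u = (\<lambda>c. if c = k then 0 else psum x c)"
  have kn: "psum x (a + k) + psum x (a - k - 1) = psum x a + psum x (a - 1)"
    if "0 \<le> a" "a < int n" for a
    using x that k unfolding mat_kernel_A_mat_iff[OF xc] by auto
  have n': "int n \<ge> 1" using n by simp
  have uX: "u c = psum x c" if "0 \<le> c" "c < k" for c using that unfolding u_def by simp
  have uk: "u k = 0" unfolding u_def by simp
  note ctx = k n' psum_neg uX uk kn
  \<comment> \<open>Partial sums do not change from index \<open>n - 1\<close> on, so
    \<open>u\<close> is constant along edges.\<close>
  have "\<forall>(x, y) \<in> G_edges (int n) k. u x = u y"
    using psum_ge[of x] dx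
    by (subst eventually_const_iff_edges[OF ctx, symmetric]) auto
  moreover have "u (k - w) = 0" if "w \<in> L" for w
    using z[OF that] that L dx unfolding u_def psum_def by auto
  ultimately have "u c = 0" if "0 \<le> c" "c < k" for c
    using sep[of u] uk that by blast
  hence "psum x c = 0" if "0 \<le> c" "c < k" for c using that uX by simp
  hence z: "psum x c = 0" if "c < int n + k" for c
    using zero_if_initially_zero[OF ctx] that by blast
  show "x = 0\<^sub>v n"
  proof (rule eq_vecI)
    fix l assume "l < dim_vec (0\<^sub>v n :: real vec)"
    hence l: "l < n" by simp
    have "x $ l = 0" using psum_step[of l x] z[of "int l"] z[of "int l - 1"] l dx k by simp
    thus "x $ l = 0\<^sub>v n $ l" using l by simp
  qed (use dx in simp)
next
  define u where "u = (\<lambda>w x. if h x = w then 1 else 0 :: real)"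
  \<comment> \<open>The kernel vector of component \<open>w\<close>: differences of the sequence
    unfolded from the indicator of that component.\<close>
  define b where "b = (\<lambda>w. vec n (\<lambda>l. unfold_seq k (u w) (int l) - unfold_seq k (u w) (int l - 1)))"
  have psum_b_aux: "psum (b w) (int c - 1) = unfold_seq k (u w) (int c - 1)" if "c \<le> n" for w c
    using that
  proof (induction c)
    case 0 thus ?case using k by (simp add: psum_neg unfold_seq_neg)
  next
    case (Suc c)
    thus ?case using psum_step[of c "b w"] by (simp add: b_def)
  qed
  have psum_b: "psum (b w) c = unfold_seq k (u w) c" if "c < int n" for w c
  proof (cases "c < 0")
    case True thus ?thesis using k by (simp add: psum_neg unfold_seq_neg)
  next
    case False
    thus ?thesis using psum_b_aux[of "nat (c + 1)" w] that by simp
  qed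
  have seq_u: "unfold_seq k (u w) c = u w c" if "0 \<le> c" "c < k" for w c
    using that k by (simp add: unfold_seq_step unfold_seq_neg)
  have uk: "u w k = 0" if "w \<in> L" for w using h_k that unfolding u_def by auto
  \<comment> \<open>Past the end both sides are constant: the partial sums trivially, the unfolded
    sequence because the indicator is constant along edges.\<close>
  have ext: "psum (b w) c = unfold_seq k (u w) c" if w: "w \<in> L" and c: "c < int n + k" for w c
  proof (cases "c < int n")
    case False
    have n': "int n \<ge> 1" using n by simp
    let ?X = "unfold_seq k (u w)"
    have "\<forall>(x, y) \<in> G_edges (int n) k. u w x = u w y"
      using h_edge unfolding u_def by auto
    hence const: "\<forall>c. int n \<le> c \<and> c < int n + k \<longrightarrow> ?X c = ?X (c - 1)"
      using eventually_const_iff_edges[OF k n', of ?X "u w"] k w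
      by (auto simp: unfold_seq_neg seq_u uk unfold_seq_rec)
    from False have "int n - 1 \<le> c" by simp
    thus ?thesis using c
    proof (induction c rule: int_ge_induct)
      case base thus ?case using psum_b by simp
    next
      case (step c)
      have "psum (b w) (c + 1) = psum (b w) c"
        using step by (intro psum_ge) (auto simp: b_def)
      thus ?case using step const[rule_format, of "c + 1"] by auto
    qed
  qed (use psum_b in auto)
  show "b w \<in> mat_kernel (A_mat n (nat k))" if w: "w \<in> L" for w
  proof -
    have bc: "b w \<in> carrier_vec n" by (simp add: b_def)
    show ?thesis unfolding mat_kernel_A_mat_iff[OF bc]
      using k unfold_seq_rec[of k "u w", OF k uk[OF w]] by (auto simp: ext[OF w])
  qed
  fix w w' assume w: "w \<in> L" "w' \<in> L"
  have wk: "1 \<le> w" "w \<le> k" using w L by auto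
  have wn: "unfold_seq k (u w') (k - w) = (if w = w' then 1 else 0)"
    using wk h_L[OF w(1)] seq_u[of "k - w" w'] by (simp add: u_def)
  have "(\<Sum>l<n. (if int l \<le> k - w then 1 else 0) * b w' $ l) = psum (b w') (k - w)"
    unfolding psum_def by (simp add: b_def)
  also have "\<dots> = unfold_seq k (u w') (k - w)"
    using wk n by (intro ext[OF w(2)]) simp
  finally show "(\<Sum>l<n. (if int l \<le> k - w then 1 else 0) * b w' $ l) = (if w = w' then 1 else 0)"
    using wn by simp
qed

section \<open>The graphs and their shifts\<close>

text \<open>Counting from 0 shows that the sources are \<open>k\<close> consecutive residues modulo
  \<open>k + 1\<close>; the residue left out, \<open>n - 2\<close>, is the sink.\<close>

lemma G_edges_iff:
  "(x, y) \<in> G_edges n k \<longleftrightarrow>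
    (\<exists>i. 0 \<le> i \<and> i < k \<and> x = (i + n - 1) mod (k + 1) \<and> y = (i + n) mod k)"
proof
  assume "(x, y) \<in> G_edges n k"
  then obtain i where "1 \<le> i" "i \<le> k" "x = (i + n - 2) mod (k + 1)" "y = (i + n - 1) mod k"
    unfolding G_edges_def by auto
  thus "\<exists>i. 0 \<le> i \<and> i < k \<and> x = (i + n - 1) mod (k + 1) \<and> y = (i + n) mod k"
    by (intro exI[of _ "i - 1"]) (simp add: algebra_simps)
next
  assume "\<exists>i. 0 \<le> i \<and> i < k \<and> x = (i + n - 1) mod (k + 1) \<and> y = (i + n) mod k"
  then obtain i where "0 \<le> i" "i < k" "x = (i + n - 1) mod (k + 1)" "y = (i + n) mod k" by auto
  thus "(x, y) \<in> G_edges n k"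
    unfolding G_edges_def by (auto intro!: exI[of _ "i + 1"] simp: algebra_simps)
qed

lemma mod_eq_imp_eq:
  fixes i i' a p :: int
  assumes "(i + a) mod p = (i' + a) mod p" "0 \<le> i" "i < p" "0 \<le> i'" "i' < p"
  shows "i = i'"
proof -
  have "p dvd i - i'" using assms(1) by (metis add_diff_cancel_right mod_eq_dvd_iff)
  thus ?thesis using assms by (metis mod_eq_dvd_iff mod_pos_pos_trivial)
qed

lemma mod_eqI: "a = b + p * c \<Longrightarrow> a mod p = b mod p" for a b c p :: int
  by simp

lemma G_edges_functional:
  assumes "(x, y) \<in> G_edges n k" "(x, y') \<in> G_edges n k"
  shows "y = y'"
proof -
  obtain i i' where i: "0 \<le> i" "i < k" "x = (i + n - 1) mod (k + 1)" "y = (i + n) mod k"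
    "0 \<le> i'" "i' < k" "x = (i' + n - 1) mod (k + 1)" "y' = (i' + n) mod k"
    using assms unfolding G_edges_iff by auto
  hence "i = i'" by (intro mod_eq_imp_eq[of i "n - 1" "k + 1" i']) (auto simp: algebra_simps)
  thus ?thesis using i by simp
qed

text \<open>The period \<open>k (k + 1)\<close> is a multiple of both moduli.\<close>

lemma G_edges_mod: "G_edges (n mod (k\<^sup>2 + k) + (k\<^sup>2 + k)) k = G_edges n k"
proof -
  let ?K = "k\<^sup>2 + k" and ?n = "n mod (k\<^sup>2 + k) + (k\<^sup>2 + k)"
  have K: "?K = k * (k + 1)" by (simp add: power2_eq_square algebra_simps)
  have n: "?n = n + ?K * (1 - n div ?K)" by (simp add: algebra_simps minus_div_mult_eq_mod[symmetric])
  define z where "z = 1 - n div ?K"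
  have n': "?n = n + k * (k + 1) * z" using n unfolding K z_def .
  have "(i + ?n - 1) mod (k + 1) = (i + n - 1) mod (k + 1)" for i
  proof -
    have "i + ?n - 1 = (i + n - 1) + (k + 1) * (k * z)" unfolding n' by (simp add: algebra_simps)
    thus ?thesis by (metis mod_mult_self2)
  qed
  moreover have "(i + ?n) mod k = (i + n) mod k" for i
  proof -
    have "i + ?n = (i + n) + k * ((k + 1) * z)" unfolding n' by (simp add: algebra_simps)
    thus ?thesis by (metis mod_mult_self2)
  qed
  ultimately have "(x, y) \<in> G_edges ?n k \<longleftrightarrow> (x, y) \<in> G_edges n k" for x y
    unfolding G_edges_iff by presburger
  thus ?thesis by auto
qed

lemma N_eq_card_components:
  fixes k n :: int
  assumes k: "k \<ge> 1" and L: "L \<subseteq> {1..k}"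
    and h_edge: "\<And>x y. (x, y) \<in> G_edges n k \<Longrightarrow> h x = h y"
    and h_k: "h k \<notin> L" and h_L: "\<And>w. w \<in> L \<Longrightarrow> h (k - w) = w"
    and sep: "\<And>u :: int \<Rightarrow> real. u k = 0 \<Longrightarrow> (\<And>x y. (x, y) \<in> G_edges n k \<Longrightarrow> u x = u y) \<Longrightarrow>
       (\<And>w. w \<in> L \<Longrightarrow> u (k - w) = 0) \<Longrightarrow> (\<And>x. 0 \<le> x \<Longrightarrow> x < k \<Longrightarrow> u x = 0)"
  shows "N n k = card L"
proof -
  let ?n = "n mod (k\<^sup>2 + k) + (k\<^sup>2 + k)"
  have "k\<^sup>2 + k > 0" using k by (simp add: add_nonneg_pos)
  hence n: "?n \<ge> 1" by (smt (verit) pos_mod_sign)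
  hence "G_edges (int (nat ?n)) k = G_edges n k" by (simp add: G_edges_mod)
  thus ?thesis unfolding N_def
    using n by (intro nullity_eq_card_components[OF k _ L, where h = h]) (use h_edge h_k h_L sep in auto)
qed

text \<open>Passing from \<open>n\<close> to \<open>n + 1\<close> moves the source of a single edge by one, from the successor
  of the sink to the sink itself; iterating moves \<open>d\<close> consecutive sources.\<close>
lemma G_edges_shift_up:
  assumes d: "0 \<le> d" "d \<le> k"
  shows "(x, y) \<in> G_edges (n + d) k \<longleftrightarrow> (\<exists>i. 0 \<le> i \<and> i < k \<and> y = (i + n) mod k \<and>
    x = (if i < d then (i + n - 2) mod (k + 1) else (i + n - 1) mod (k + 1)))" (is "_ = ?R")
proof
  assume "(x, y) \<in> G_edges (n + d) k"
  then obtain i where i: "0 \<le> i" "i < k" "x = (i + (n + d) - 1) mod (k + 1)" "y = (i + (n + d)) mod k"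
    unfolding G_edges_iff by auto
  show ?R
  proof (cases "i + d < k")
    case True
    thus ?thesis using i d by (intro exI[of _ "i + d"]) (simp add: algebra_simps)
  next
    case False
    \<comment> \<open>Wrapping lowers the index by \<open>k\<close>: the target is unaffected modulo
      \<open>k\<close>, but the source changes by one modulo \<open>k + 1\<close>.\<close>
    have "(i + (n + d)) mod k = (i + d - k + n) mod k"
      using mod_add_self2[of "i + d - k + n" k] by (simp add: algebra_simps)
    moreover have "(i + (n + d) - 1) mod (k + 1) = (i + d - k + n - 2) mod (k + 1)"
      using mod_add_self2[of "i + d - k + n - 2" "k + 1"] by (simp add: algebra_simps)
    ultimately show ?thesis using False i d by (intro exI[of _ "i + d - k"]) simp
  qed
next
  assume ?R
  then obtain i where i: "0 \<le> i" "i < k" "y = (i + n) mod k"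
    "x = (if i < d then (i + n - 2) mod (k + 1) else (i + n - 1) mod (k + 1))" by auto
  show "(x, y) \<in> G_edges (n + d) k"
  proof (cases "i < d")
    case True
    have "(i - d + k + (n + d)) mod k = (i + n) mod k"
      using mod_add_self2[of "i + n" k] by (simp add: algebra_simps)
    moreover have "(i - d + k + (n + d) - 1) mod (k + 1) = (i + n - 2) mod (k + 1)"
      using mod_add_self2[of "i + n - 2" "k + 1"] by (simp add: algebra_simps)
    ultimately show ?thesis unfolding G_edges_iff using True i d
      by (intro exI[of _ "i - d + k"]) simp
  next
    case False
    thus ?thesis unfolding G_edges_iff using i d
      by (intro exI[of _ "i - d"]) simp
  qed
qed

text \<open>The mirror image: the sources of the last \<open>d\<close> edges move forward by one,
  the very last of them onto the old sink.\<close>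

lemma G_edges_shift_down:
  assumes d: "0 \<le> d" "d \<le> k"
  shows "(x, y) \<in> G_edges (n - d) k \<longleftrightarrow> (\<exists>i. 0 \<le> i \<and> i < k \<and> y = (i + n) mod k \<and>
    x = (if k - d \<le> i then (i + n) mod (k + 1) else (i + n - 1) mod (k + 1)))" (is "_ = ?R")
proof
  assume "(x, y) \<in> G_edges (n - d) k"
  then obtain i where i: "0 \<le> i" "i < k" "x = (i + (n - d) - 1) mod (k + 1)" "y = (i + (n - d)) mod k"
    unfolding G_edges_iff by auto
  show ?R
  proof (cases "d \<le> i")
    case True
    thus ?thesis using i d by (intro exI[of _ "i - d"]) (simp add: algebra_simps)
  next
    case False
    have "(i + (n - d)) mod k = (i - d + k + n) mod k"
      using mod_add_self2[of "i - d + n" k] by (simp add: algebra_simps)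
    moreover have "(i + (n - d) - 1) mod (k + 1) = (i - d + k + n) mod (k + 1)"
      using mod_add_self2[of "i - d + n - 1" "k + 1"] by (simp add: algebra_simps)
    ultimately show ?thesis using False i d by (intro exI[of _ "i - d + k"]) simp
  qed
next
  assume ?R
  then obtain i where i: "0 \<le> i" "i < k" "y = (i + n) mod k"
    "x = (if k - d \<le> i then (i + n) mod (k + 1) else (i + n - 1) mod (k + 1))" by auto
  show "(x, y) \<in> G_edges (n - d) k"
  proof (cases "k - d \<le> i")
    case True
    have "(i + d - k + (n - d)) mod k = (i + n) mod k"
      using mod_add_self2[of "i + n - k" k] by (simp add: algebra_simps)
    moreover have "(i + d - k + (n - d) - 1) mod (k + 1) = (i + n) mod (k + 1)"
      using mod_add_self2[of "i + n - k - 1" "k + 1"] by (simp add: algebra_simps)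
    ultimately show ?thesis unfolding G_edges_iff using True i d
      by (intro exI[of _ "i + d - k"]) simp
  next
    case False
    thus ?thesis unfolding G_edges_iff using i d
      by (intro exI[of _ "i + d"]) simp
  qed
qed

section \<open>The cycles at a peak\<close>

locale farey_index =
  fixes k q j :: int
  assumes q: "1 \<le> q" "q \<le> k" and j: "1 \<le> j" "j \<le> q" and cop: "coprime j q"
begin

abbreviation "f \<equiv> fq k q"
abbreviation "m \<equiv> mq k q"

text \<open>\<open>rho r\<close> is the arc reached after \<open>r\<close> rotation steps, and
  \<open>carry r\<close> tells whether the next step passes arc 0.\<close>

definition rho :: "int \<Rightarrow> int" where "rho r = (r * j) mod q"
definition carry :: "int \<Rightarrow> int" where "carry r = (rho r + j) div q"
definition cnt :: "int \<Rightarrow> int" where "cnt x = (\<Sum>a\<in>{0..m}. of_bool (rho a < x))"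
text \<open>The number of vertices in the arcs before \<open>x\<close>: every arc holds one vertex
  of each of the \<open>f\<close> cycles, and the arcs satisfying \<open>occ\<close> also hold one
  vertex of the path.\<close>

definition F :: "int \<Rightarrow> int" where "F x = x * f + cnt x"
definition occ :: "int \<Rightarrow> bool" where "occ x \<longleftrightarrow> x \<in> rho ` {0..m}"

lemma f_pos: "f \<ge> 1"
  unfolding fq_def using q by (simp add: pos_imp_zdiv_pos_iff int_one_le_iff_zero_less)

lemma m_mod: "m = k mod q"
  unfolding mq_def fq_def by (simp add: minus_div_mult_eq_mod)

lemma m_range: "0 \<le> m" "m < q"
  unfolding m_mod using q by auto

lemma k_eq: "k = f * q + m"
  unfolding mq_def by simp

lemma f_le_k: "f \<le> k"
proof -
  have "f * 1 \<le> f * q" using f_pos q by (intro mult_left_mono) auto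
  thus ?thesis using k_eq m_range by linarith
qed

lemma rho_range: "0 \<le> rho r" "rho r < q"
  unfolding rho_def using q by auto

lemma rho_0: "rho 0 = 0" unfolding rho_def by simp

lemma rho_eq_iff: "rho r = rho r' \<longleftrightarrow> r mod q = r' mod q"
proof -
  have "rho r = rho r' \<longleftrightarrow> q dvd (r - r') * j"
    unfolding rho_def by (simp add: mod_eq_dvd_iff left_diff_distrib)
  also have "\<dots> \<longleftrightarrow> q dvd r - r'"
    using cop by (simp add: coprime_dvd_mult_left_iff coprime_commute)
  finally show ?thesis by (simp add: mod_eq_dvd_iff)
qed

lemma rho_inj:
  assumes "rho a = rho b" "0 \<le> a" "a < q" "0 \<le> b" "b < q"
  shows "a = b"
  using assms unfolding rho_eq_iff by simp

lemma rho_surj: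
  assumes "0 \<le> x" "x < q"
  obtains r where "0 \<le> r" "r < q" "rho r = x"
proof -
  have "inj_on rho {0..<q}" using rho_inj by (intro inj_onI) auto
  moreover have "rho ` {0..<q} \<subseteq> {0..<q}" using rho_range by auto
  ultimately have "rho ` {0..<q} = {0..<q}" by (simp add: endo_inj_surj)
  hence "x \<in> rho ` {0..<q}" using assms by simp
  thus ?thesis using that by auto
qed

lemma rho_Suc: "rho (r + 1) = rho r + j - q * carry r"
proof -
  have "rho (r + 1) = (rho r + j) mod q"
    unfolding rho_def by (simp add: distrib_right mod_add_left_eq)
  thus ?thesis unfolding carry_def by (simp add: minus_mult_div_eq_mod)
qed

lemma carry_cases: "carry r = 0 \<or> carry r = 1"
proof -
  have "carry r \<ge> 0" unfolding carry_def using rho_range[of r] j q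
    by (simp add: pos_imp_zdiv_nonneg_iff)
  moreover have "q * carry r < q * 2"
    using rho_Suc[of r] rho_range[of r] rho_range[of "r + 1"] j by linarith
  hence "carry r < 2" using q by simp
  ultimately show ?thesis by auto
qed

lemma div_Suc_carry: "((r + 1) * j) div q = (r * j) div q + carry r"
proof -
  have "(r + 1) * j = rho r + j + q * ((r * j) div q)"
    unfolding rho_def by (simp add: algebra_simps)
  thus ?thesis unfolding carry_def using q by simp
qed

lemma sum_carry:
  assumes "M \<ge> 0"
  shows "(\<Sum>a\<in>{0..<M}. carry a) = (M * j) div q"
  using assms
proof (induction M rule: int_ge_induct)
  case (step M)
  have "{0..<M + 1} = insert M {0..<M}" using step by auto
  thus ?case using step by (simp add: div_Suc_carry)
qed simp

lemma occ_rho: "occ (rho r) \<longleftrightarrow> r mod q \<le> m"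
proof
  assume "occ (rho r)"
  then obtain a where "0 \<le> a" "a \<le> m" "rho r = rho a" unfolding occ_def by auto
  thus "r mod q \<le> m" using m_range unfolding rho_eq_iff by simp
next
  assume "r mod q \<le> m"
  moreover have "rho r = rho (r mod q)" unfolding rho_eq_iff by simp
  ultimately show "occ (rho r)" unfolding occ_def using q by auto
qed

lemma cnt_0: "cnt 0 = 0"
  unfolding cnt_def using rho_range by (intro sum.neutral) (auto simp: not_less)

lemma cnt_q: "cnt q = m + 1"
  unfolding cnt_def using rho_range m_range by simp

lemma cnt_Suc: "cnt (x + 1) = cnt x + of_bool (occ x)"
proof -
  have "cnt (x + 1) = cnt x + (\<Sum>a\<in>{0..m}. of_bool (rho a = x))"
    unfolding cnt_def sum.distrib[symmetric] by (intro sum.cong) auto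
  also have "(\<Sum>a\<in>{0..m}. of_bool (rho a = x)) = (of_bool (occ x) :: int)"
  proof (cases "occ x")
    case True
    then obtain b where b: "b \<in> {0..m}" "x = rho b" unfolding occ_def by auto
    have "(\<Sum>a\<in>{0..m}. of_bool (rho a = x)) = (\<Sum>a\<in>{0..m}. if a = b then 1 else 0 :: int)"
    proof (intro sum.cong refl)
      fix a assume "a \<in> {0..m}"
      hence "rho a = x \<longleftrightarrow> a = b" using b rho_inj[of a b] m_range by auto
      thus "of_bool (rho a = x) = (if a = b then 1 else 0 :: int)" by simp
    qed
    also have "\<dots> = 1" using b by simp
    finally show ?thesis using True by simp
  next
    case False
    thus ?thesis unfolding occ_def by (auto intro!: sum.neutral)
  qed
  finally show ?thesis .
qed

lemma cnt_mono: "x \<le> y \<Longrightarrow> cnt x \<le> cnt y"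
  unfolding cnt_def by (intro sum_mono) auto

lemma F_0: "F 0 = 0" unfolding F_def by (simp add: cnt_0)

lemma F_q: "F q = k + 1"
  unfolding F_def cnt_q using k_eq by (simp add: algebra_simps)

lemma F_Suc: "F (x + 1) = F x + f + of_bool (occ x)"
  unfolding F_def cnt_Suc by (simp add: algebra_simps)

lemma F_mono: "x \<le> y \<Longrightarrow> F x \<le> F y"
  unfolding F_def using f_pos cnt_mono by (intro add_mono mult_right_mono) auto

lemma F_less: "x < y \<Longrightarrow> F x + f + of_bool (occ x) \<le> F y"
  using F_mono[of "x + 1" y] F_Suc[of x] by simp

lemma F_less_weak: "x < y \<Longrightarrow> F x + f \<le> F y"
  using F_less[of x y] by (auto simp: of_bool_def split: if_splits)

lemma F_less_occ: "occ x \<Longrightarrow> x < y \<Longrightarrow> F x + f + 1 \<le> F y"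
  using F_less[of x y] by simp

lemma occ_0: "occ 0"
  unfolding occ_def using rho_0 m_range by (auto intro: rev_image_eqI)

text \<open>Rotating all points by one step changes comparisons only through carries, which sum to
  \<open>(m * j) div q\<close>. In the count, the point \<open>rho 0\<close> enters and
  \<open>rho m\<close> leaves, giving the two indicators; \<open>f * q + m = k\<close> collects the
  multiples of \<open>carry r\<close>.\<close>

lemma F_step:
  "F (rho (r + 1)) = F (rho r) + f * j + (m * j) div q - k * carry r
     + of_bool (rho (r + 1) > 0) - of_bool (rho m < rho r)"
proof -
  \<comment> \<open>If exactly one of the two points passes arc 0, their order is reversed.\<close>
  have ind: "of_bool (rho (a + 1) < rho (r + 1)) = of_bool (rho a < rho r) + carry a - carry r" for a
    using carry_cases[of a] carry_cases[of r] rho_Suc[of a] rho_Suc[of r]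
      rho_range[of a] rho_range[of r] rho_range[of "a + 1"] rho_range[of "r + 1"]
    by (elim disjE) auto
  have s1: "{0..m} = insert 0 ((\<lambda>a. a + 1) ` {0..<m})"
    using m_range by (auto simp: image_iff intro: bexI[of _ "_ - 1"])
  have "cnt (rho (r + 1)) = of_bool (rho (r + 1) > 0) + (\<Sum>a\<in>{0..<m}. of_bool (rho (a + 1) < rho (r + 1)))"
    unfolding cnt_def s1
    by (subst sum.insert)
      (auto simp: rho_0 sum.reindex comp_def simp del: sum_of_bool_eq image_add_atLeastLessThan')
  also have "(\<Sum>a\<in>{0..<m}. of_bool (rho (a + 1) < rho (r + 1)))
      = (\<Sum>a\<in>{0..<m}. of_bool (rho a < rho r)) + (m * j) div q - m * carry r"
    using m_range unfolding ind by (simp add: sum_subtractf sum.distrib sum_carry del: sum_of_bool_eq)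
  also have "(\<Sum>a\<in>{0..<m}. of_bool (rho a < rho r)) = cnt (rho r) - of_bool (rho m < rho r)"
  proof -
    have "{0..m} = insert m {0..<m}" using m_range by auto
    thus ?thesis unfolding cnt_def by (simp del: sum_of_bool_eq)
  qed
  finally have c: "cnt (rho (r + 1)) = of_bool (rho (r + 1) > 0) +
    (cnt (rho r) - of_bool (rho m < rho r) + (m * j) div q - m * carry r)" .
  have "rho (r + 1) * f = rho r * f + f * j - (f * q) * carry r"
    unfolding rho_Suc by (simp add: algebra_simps)
  moreover have "(f * q) * carry r + m * carry r = k * carry r"
    using k_eq by (metis distrib_right)
  ultimately show ?thesis unfolding F_def c by simp
qed

text \<open>Equality never occurs in the count because \<open>m + 1 - a\<close> lies strictly
  between 0 and \<open>q\<close>; the correction term removes \<open>a = 0\<close>.\<close>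

lemma s_fun_eq: "s_fun k q j = cnt (rho (m + 1)) - of_bool (rho (m + 1) > 0)"
proof -
  have ne: "rho a \<noteq> rho (m + 1)" if "1 \<le> a" "a \<le> m" for a
  proof
    assume "rho a = rho (m + 1)"
    hence "q dvd m + 1 - a" unfolding rho_eq_iff by (metis mod_eq_dvd_iff)
    thus False using that m_range by (auto dest: zdvd_imp_le)
  qed
  have s1: "{0..m} = insert 0 {1..m}" using m_range by auto
  have "s_fun k q j = (\<Sum>a\<in>{1..m}. of_bool (rho a \<le> rho (m + 1)))"
    unfolding s_fun_def Mq_def rho_def[symmetric] by (simp add: sum_of_bool_eq Int_def)
  also have "\<dots> = (\<Sum>a\<in>{1..m}. of_bool (rho a < rho (m + 1)))"
    using ne by (intro sum.cong) (auto simp: order.order_iff_strict)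
  also have "\<dots> = cnt (rho (m + 1)) - of_bool (rho (m + 1) > 0)"
    unfolding cnt_def s1 by (simp add: rho_0 del: sum_of_bool_eq)
  finally show ?thesis .
qed

lemma eta_quotient: "((k + 1) * j) div q = f * j + (m * j) div q + carry m"
proof -
  have "(k + 1) * j = (m + 1) * j + q * (f * j)"
    using k_eq by (metis add.commute add.left_commute distrib_right mult.assoc mult.commute)
  hence "((k + 1) * j) div q = f * j + ((m + 1) * j) div q" using q by simp
  thus ?thesis unfolding div_Suc_carry by simp
qed

lemma eta_residue: "eta k q j = k * (((k + 1) * j) div q - 1) + F (rho (m + 1)) - of_bool (rho (m + 1) > 0)"
  unfolding eta_def Mq_def rho_def[symmetric] s_fun_eq F_def by (simp add: algebra_simps)

text \<open>While \<open>eta_residue\<close> is adapted to the modulus \<open>k\<close>, this form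
  is adapted to \<open>k + 1\<close>: it shows that the sink \<open>eta k q j - 2\<close> is the end
  \<open>pos m 0\<close> of the path.\<close>

lemma eta_eq: "eta k q j = (k + 1) * (f * j + (m * j) div q) - k + F (rho m)"
  unfolding eta_residue eta_quotient F_step[of m] by (simp add: algebra_simps)

section \<open>Vertices and edges at a peak\<close>

text \<open>\<open>pos r w\<close> is the vertex at step \<open>r\<close> of the cycle \<open>w\<close>; the value \<open>w = 0\<close> encodes the
  path, which only has the steps \<open>0, \<dots>, m\<close>.\<close>
definition pos :: "int \<Rightarrow> int \<Rightarrow> int" where
  "pos r w = (F (rho r) - 1 - w) mod (k + 1)"

definition valid :: "int \<Rightarrow> int \<Rightarrow> bool" where
  "valid r w \<longleftrightarrow> (1 \<le> w \<and> w \<le> f) \<or> (w = 0 \<and> occ (rho r))"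

text \<open>Before reduction the vertices lie in a window of \<open>k + 1\<close> integers, so
  reduction modulo \<open>k + 1\<close> identifies no two of them.\<close>

lemma pos_window:
  assumes "valid r w"
  shows "- 1 - f \<le> F (rho r) - 1 - w" "F (rho r) - 1 - w \<le> k - 1 - f"
proof -
  have "F (rho r) \<ge> 0" using F_mono[of 0 "rho r"] rho_range[of r] F_0 by simp
  thus "- 1 - f \<le> F (rho r) - 1 - w" using assms f_pos unfolding valid_def by auto
  show "F (rho r) - 1 - w \<le> k - 1 - f"
    using assms F_less_weak[of "rho r" q] F_less_occ[of "rho r" q] rho_range[of r] F_q
    unfolding valid_def by auto
qed

text \<open>The vertices on one arc form a block of consecutive integers, and the growth of
  \<open>F\<close> keeps different blocks apart.\<close>

lemma pos_inj:
  assumes "valid r w" "valid r' w'" "pos r w = pos r' w'"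
  shows "rho r = rho r'" "w = w'"
proof -
  have "F (rho r) - w + f = F (rho r') - w' + f"
  proof (rule mod_eq_imp_eq[where a = "- 1 - f" and p = "k + 1"])
    show "(F (rho r) - w + f + (- 1 - f)) mod (k + 1) = (F (rho r') - w' + f + (- 1 - f)) mod (k + 1)"
      using assms(3) unfolding pos_def by (simp add: algebra_simps)
  qed (use pos_window[OF assms(1)] pos_window[OF assms(2)] in auto)
  hence eq: "F (rho r) - 1 - w = F (rho r') - 1 - w'" by simp
  have "False" if "rho s < rho s'" "valid s v" "valid s' v'" "F (rho s) - 1 - v = F (rho s') - 1 - v'"
    for s s' v v'
    using F_less_weak[OF that(1)] F_less_occ[OF _ that(1)] that(2-) f_pos unfolding valid_def by auto
  from this[of r r' w w'] this[of r' r w' w] eq assms show "rho r = rho r'"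
    by (metis linorder_less_linear)
  with eq show "w = w'" by simp
qed

lemma pos_cong: "r mod q = r' mod q \<Longrightarrow> pos r w = pos r' w"
  unfolding pos_def rho_eq_iff[symmetric] by simp

lemma pos_0: "0 \<le> w \<Longrightarrow> w \<le> k \<Longrightarrow> pos 0 w = k - w"
proof -
  assume w: "0 \<le> w" "w \<le> k"
  have "pos 0 w = (- 1 - w + (k + 1)) mod (k + 1)"
    unfolding pos_def rho_0 F_0 by (simp only: mod_add_self2) simp
  also have "\<dots> = (k - w) mod (k + 1)" by (simp add: algebra_simps)
  also have "\<dots> = k - w" using w by (intro mod_pos_pos_trivial) auto
  finally show ?thesis .
qed

lemma pos_pos:
  assumes "valid r w" "rho r > 0"
  shows "pos r w = F (rho r) - 1 - w" "0 \<le> pos r w" "pos r w < k"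
proof -
  have "F (rho r) \<ge> f + 1" using F_less_occ[OF occ_0 assms(2)] F_0 by simp
  hence "0 \<le> F (rho r) - 1 - w" using assms f_pos unfolding valid_def by auto
  moreover have "F (rho r) - 1 - w < k" using pos_window[OF assms(1)] f_pos by simp
  ultimately show "pos r w = F (rho r) - 1 - w" "0 \<le> pos r w" "pos r w < k"
    unfolding pos_def by auto
qed

lemma pos_surj:
  assumes "0 \<le> x" "x \<le> k"
  obtains r w where "0 \<le> r" "r < q" "valid r w" "x = pos r w"
proof -
  define y where "y = (if x \<le> k - 1 - f then x else x - k - 1)"
  have xy: "x = y mod (k + 1)"
  proof (cases "x \<le> k - 1 - f")
    case True thus ?thesis using assms f_pos unfolding y_def by simp
  next
    case False
    have "y mod (k + 1) = (y + (k + 1)) mod (k + 1)" by simp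
    thus ?thesis using assms False unfolding y_def by simp
  qed
  define z where "z = y + 1 + f"
  have z: "0 \<le> z" "z < k + 1" using assms f_pos f_le_k unfolding z_def y_def by auto
  \<comment> \<open>The blocks tile the window from \<open>F 0 = 0\<close> to
    \<open>F q = k + 1\<close>, so some arc \<open>v\<close> contains the offset
    \<open>z\<close>.\<close>
  have "\<exists>v. 0 \<le> v \<and> v < q \<and> F v \<le> z \<and> z < F (v + 1)"
  proof (rule ccontr)
    assume no: "\<not> ?thesis"
    have "F v \<le> z" if "0 \<le> v" "v \<le> q" for v
      using that
    proof (induction v rule: int_ge_induct)
      case base thus ?case using z F_0 by simp
    next
      case (step v) thus ?case using no by force
    qed
    from this[of q] show False using z F_q q by simp
  qed
  then obtain v where v: "0 \<le> v" "v < q" "F v \<le> z" "z < F (v + 1)" by auto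
  obtain r where r: "0 \<le> r" "r < q" "rho r = v" using rho_surj v by blast
  have "valid r (F v - 1 - y)"
    using v r F_Suc[of v] unfolding valid_def z_def by (cases "occ v") auto
  thus ?thesis using that[of r "F v - 1 - y"] r xy unfolding pos_def by simp
qed

lemma valid_Suc:
  assumes "valid r w" "\<not> (w = 0 \<and> rho r = rho m)"
  shows "valid (r + 1) w" "w = 0 \<Longrightarrow> rho (r + 1) > 0"
proof -
  have "rho (r + 1) > 0 \<and> occ (rho (r + 1))" if "w = 0"
  proof -
    define a where "a = r mod q"
    have a: "0 \<le> a" "a \<le> m" "rho a = rho r"
      using that assms(1) q unfolding valid_def occ_rho a_def by (auto simp: rho_eq_iff)
    hence "a \<noteq> m" using assms(2) that by auto
    hence a1: "0 < a + 1" "a + 1 \<le> m" using a by auto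
    have eq: "rho (r + 1) = rho (a + 1)"
      unfolding rho_eq_iff a_def by (simp add: mod_add_left_eq)
    have "rho (a + 1) \<noteq> rho 0" using rho_inj[of "a + 1" 0] a1 m_range by auto
    thus ?thesis using eq a1 rho_range[of "a + 1"] unfolding occ_def rho_0 by auto
  qed
  thus "valid (r + 1) w" "w = 0 \<Longrightarrow> rho (r + 1) > 0"
    using assms(1) unfolding valid_def by auto
qed

lemma edge_exists:
  assumes v: "valid r w" and nD: "\<not> (w = 0 \<and> rho r = rho m)"
  obtains i where "0 \<le> i" "i < k" "pos r w = (i + eta k q j - 1) mod (k + 1)"
    "pos (r + 1) w = (i + eta k q j) mod k"
proof -
  \<comment> \<open>The source determines \<open>i\<close> modulo \<open>k + 1\<close>;
    \<open>\<delta>\<close> selects the representative between 0 and \<open>k - 1\<close>.\<close>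
  define \<delta> :: int where "\<delta> = of_bool (rho m < rho r)"
  define i where "i = F (rho r) - F (rho m) - 1 - w + (1 - \<delta>) * (k + 1)"
  define z where "z = f * j + (m * j) div q"
  have w: "0 \<le> w" "w \<le> f" using v f_pos unfolding valid_def by auto
  have occm: "occ (rho m)" unfolding occ_def using m_range by auto
  have Fm: "0 \<le> F (rho m)" "F (rho m) \<le> k - f"
    using F_mono[of 0 "rho m"] F_less_occ[of "rho m" q] rho_range[of m] F_0 F_q occm by auto
  have Fr: "0 \<le> F (rho r)" "F (rho r) \<le> k + 1 - f"
    using F_mono[of 0 "rho r"] F_less_weak[of "rho r" q] rho_range[of r] F_0 F_q by auto
  have i: "0 \<le> i \<and> i < k"
  proof (cases "rho m < rho r")
    case True
    thus ?thesis using F_less_occ[OF occm True] w Fm Fr f_pos unfolding i_def \<delta>_def by auto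
  next
    case False
    have "F (rho r) \<le> F (rho m)" using False F_mono by simp
    moreover have "w > 0 \<or> F (rho r) < F (rho m)"
      using nD False w F_less_weak[of "rho r" "rho m"] f_pos by force
    ultimately show ?thesis using False w Fm Fr unfolding i_def \<delta>_def by auto
  qed
  have "i + eta k q j - 1 = (F (rho r) - 1 - w) + (k + 1) * (z - \<delta>)"
    unfolding i_def eta_eq z_def[symmetric] by (simp add: algebra_simps)
  hence 1: "pos r w = (i + eta k q j - 1) mod (k + 1)" unfolding pos_def by (metis mod_eqI)
  have v': "valid (r + 1) w" using valid_Suc[OF v nD] by simp
  have ie: "i + eta k q j = F (rho r) - w - \<delta> + z + k * (z - \<delta>)"
    unfolding i_def eta_eq z_def[symmetric] by (simp add: algebra_simps)
  have F': "F (rho (r + 1)) = F (rho r) + z - k * carry r + of_bool (rho (r + 1) > 0) - \<delta>"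
    using F_step[of r] unfolding z_def \<delta>_def by simp
  have "(i + eta k q j) mod k = pos (r + 1) w"
  proof (cases "rho (r + 1) > 0")
    case True
    have "i + eta k q j = pos (r + 1) w + k * (z - \<delta> + carry r)"
      using F' True unfolding ie pos_pos(1)[OF v' True] by (simp add: algebra_simps)
    thus ?thesis using pos_pos[OF v' True] by simp
  next
    \<comment> \<open>On arc 0 the vertex \<open>-1 - w\<close> wraps to \<open>k - w\<close>, and
      the missing indicator in \<open>F_step\<close> accounts for the shift by one.\<close>
    case False
    hence 0: "rho (r + 1) = 0" using rho_range[of "r + 1"] by simp
    have w0: "w > 0" using valid_Suc(2)[OF v nD] False w by (cases "w = 0") auto
    have p: "pos (r + 1) w = k - w"
      using pos_0[of w] w f_le_k 0 rho_0 unfolding pos_def by simp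
    have "i + eta k q j = pos (r + 1) w + k * (z - \<delta> + carry r - 1)"
      using F' 0 F_0 unfolding ie p by (simp add: algebra_simps)
    hence "(i + eta k q j) mod k = pos (r + 1) w mod k" by (rule mod_eqI)
    also have "\<dots> = pos (r + 1) w"
      unfolding p using w0 w f_le_k by (intro mod_pos_pos_trivial) auto
    finally show ?thesis .
  qed
  thus ?thesis using that[of i] i 1 by metis
qed

lemma pos_m: "pos m w = (eta k q j - 2 - w) mod (k + 1)"
proof -
  have "eta k q j - 2 - w = (F (rho m) - 1 - w) + (k + 1) * (f * j + (m * j) div q - 1)"
    unfolding eta_eq by (simp add: algebra_simps)
  thus ?thesis unfolding pos_def by (metis mod_eqI)
qed

text \<open>On the arc following \<open>rho m\<close>, cycle \<open>f\<close> sits immediately after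
  the sink \<open>eta k q j - 2\<close>, then cycle \<open>f - 1\<close>, and so on. By
  \<open>pos_m\<close>, the cycles \<open>1, 2, ...\<close> at step \<open>m\<close> sit immediately
  before the sink.\<close>

lemma pos_above_m:
  assumes "rho s = (rho m + 1) mod q"
  shows "pos s w = (eta k q j + f - w - 1) mod (k + 1)"
proof -
  have "occ (rho m)" unfolding occ_def using m_range by auto
  hence F1: "F (rho m + 1) = F (rho m) + f + 1" using F_Suc[of "rho m"] by simp
  have "pos s w = (F (rho m + 1) - 1 - w) mod (k + 1)"
  proof (cases "rho m + 1 = q")
    case True
    hence "rho s = 0" using assms by simp
    hence "pos s w = (- 1 - w) mod (k + 1)" unfolding pos_def by (simp add: F_0)
    also have "\<dots> = (k + 1 - 1 - w) mod (k + 1)"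
      by (rule mod_eqI[where c = "- 1"]) simp
    finally show ?thesis using True F_q by simp
  next
    case False
    thus ?thesis using assms rho_range[of m] unfolding pos_def by simp
  qed
  moreover have "eta k q j + f - w - 1 = (F (rho m + 1) - 1 - w) + (k + 1) * (f * j + (m * j) div q - 1)"
    unfolding eta_eq F1 by (simp add: algebra_simps)
  ultimately show ?thesis by (metis mod_eqI)
qed

lemma edges_eta:
  assumes "valid r w" "\<not> (w = 0 \<and> rho r = rho m)"
  shows "(pos r w, pos (r + 1) w) \<in> G_edges (eta k q j) k"
  using edge_exists[OF assms] unfolding G_edges_iff by metis

lemma edges_eta_cases:
  assumes "(x, y) \<in> G_edges (eta k q j) k"
  obtains r w where "valid r w" "valid (r + 1) w" "x = pos r w" "y = pos (r + 1) w"
proof -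
  obtain i where i: "0 \<le> i" "i < k" "x = (i + eta k q j - 1) mod (k + 1)"
    using assms unfolding G_edges_iff by auto
  have "0 \<le> x" "x \<le> k" using i pos_mod_bound[of "k + 1" "i + eta k q j - 1"] by auto
  then obtain r w where r: "valid r w" "x = pos r w" using pos_surj by metis
  \<comment> \<open>The end of the path is the sink: as a source it would need the excluded index
    \<open>i = k\<close>.\<close>
  have nD: "\<not> (w = 0 \<and> rho r = rho m)"
  proof
    assume "w = 0 \<and> rho r = rho m"
    hence "x = pos m 0" using r unfolding pos_def by simp
    also have "\<dots> = (eta k q j - 2 - 0 + (k + 1)) mod (k + 1)"
      unfolding pos_m by (simp only: mod_add_self2)
    finally have "(i + (eta k q j - 1)) mod (k + 1) = (k + (eta k q j - 1)) mod (k + 1)"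
      using i by (simp add: algebra_simps)
    hence "i = k" using i by (intro mod_eq_imp_eq[of i "eta k q j - 1" "k + 1" k]) auto
    thus False using i by simp
  qed
  have "y = pos (r + 1) w" using G_edges_functional[OF assms] edges_eta[OF r(1) nD] r by auto
  thus ?thesis using that r valid_Suc[OF r(1) nD] by blast
qed

definition label :: "int \<Rightarrow> int" where
  "label x = (THE w. \<exists>r. valid r w \<and> x = pos r w)"

lemma label_pos:
  assumes "valid r w"
  shows "label (pos r w) = w"
  unfolding label_def using assms pos_inj(2) by (intro the_equality) blast+

lemma valid_0_m: "valid m 0"
  unfolding valid_def occ_def using m_range by auto

lemma valid_cycle: "1 \<le> w \<Longrightarrow> w \<le> f \<Longrightarrow> valid r w"
  unfolding valid_def by simp

text \<open>The edge closing the cycle at \<open>a\<close> is not assumed, so this also applies to a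
  cycle cut open there.\<close>

lemma pos_zero_propagate:
  fixes u :: "int \<Rightarrow> real"
  assumes "u (pos a w) = 0"
    and "\<And>r. (r - a) mod q \<noteq> q - 1 \<Longrightarrow> u (pos r w) = u (pos (r + 1) w)"
  shows "u (pos r w) = 0"
proof -
  have *: "u (pos (a + i) w) = 0" if "0 \<le> i" "i < q" for i
    using that
  proof (induction i rule: int_ge_induct)
    case base thus ?case using assms(1) by simp
  next
    case (step i)
    hence "(a + i - a) mod q \<noteq> q - 1" by simp
    from assms(2)[OF this] show ?case using step by (simp add: add.assoc)
  qed
  have "u (pos (a + (r - a) mod q) w) = 0" using q by (intro *) auto
  moreover have "pos (a + (r - a) mod q) w = pos r w"
    by (rule pos_cong) (simp add: mod_add_right_eq)
  ultimately show ?thesis by simp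
qed

section \<open>Splicing cycles into the path\<close>

text \<open>The graph obtained from \<open>G (eta k q j) k\<close> by cutting the cycles \<open>\<omega> 0, \<dots>, \<omega> (d - 1)\<close>
  at the residue \<open>s\<close> and splicing them one after the other to the end of the path.\<close>
lemma N_spliced:
  fixes n d s :: int and \<omega> :: "int \<Rightarrow> int"
  defines "W \<equiv> \<omega> ` {0..<d}"
  defines "prev \<equiv> \<lambda>e. if e = 0 then pos m 0 else pos s (\<omega> (e - 1))"
  assumes W: "W \<subseteq> {1..f}"
    and keep: "\<And>r w. valid r w \<Longrightarrow> \<not> (w = 0 \<and> rho r = rho m) \<Longrightarrow> \<not> (rho r = rho s \<and> w \<in> W) \<Longrightarrow>
      (pos r w, pos (r + 1) w) \<in> G_edges n k"
    and new: "\<And>e. 0 \<le> e \<Longrightarrow> e < d \<Longrightarrow> (prev e, pos (s + 1) (\<omega> e)) \<in> G_edges n k"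
    and only: "\<And>x y. (x, y) \<in> G_edges n k \<Longrightarrow>
      (\<exists>r w. valid r w \<and> valid (r + 1) w \<and> x = pos r w \<and> y = pos (r + 1) w) \<or>
      (\<exists>e. 0 \<le> e \<and> e < d \<and> x = prev e \<and> y = pos (s + 1) (\<omega> e))"
  shows "N n k = card ({1..f} - W)"
proof -
  have k: "k \<ge> 1" using q by simp
  \<comment> \<open>All spliced cycles share the label 0 of the path; each intact cycle keeps its
    own.\<close>
  define h where "h = (\<lambda>x. if label x \<in> W then 0 else label x)"
  have h_pos: "h (pos r w) = (if w \<in> W then 0 else w)" if "valid r w" for r w
    unfolding h_def using label_pos[OF that] by simp
  have vW: "valid r (\<omega> e)" if "0 \<le> e" "e < d" for r e
    using that W unfolding W_def by (intro valid_cycle) (auto simp: image_subset_iff)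
  have oW: "\<omega> e \<in> W" if "0 \<le> e" "e < d" for e
    using that unfolding W_def by auto
  have h_prev: "h (prev e) = 0" if "0 \<le> e" "e < d" for e
    using that h_pos[OF valid_0_m] h_pos[OF vW, of "e - 1" s] oW[of "e - 1"]
    unfolding prev_def by auto
  have p0: "pos 0 0 = k" using pos_0[of 0] k by simp
  have v00: "valid 0 0" unfolding valid_def rho_0 using occ_0 by simp
  show ?thesis
  proof (rule N_eq_card_components[OF k, where h = h])
    show "{1..f} - W \<subseteq> {1..k}" using f_le_k by auto
    show "h k \<notin> {1..f} - W" using h_pos[OF v00] unfolding p0 by auto
    show "h (k - w) = w" if "w \<in> {1..f} - W" for w
      using h_pos[OF valid_cycle, of w 0] pos_0[of w] that f_le_k by auto
    show "h x = h y" if "(x, y) \<in> G_edges n k" for x y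
      using only[OF that]
    proof (elim disjE exE conjE)
      fix e assume "0 \<le> e" "e < d" "x = prev e" "y = pos (s + 1) (\<omega> e)"
      thus ?thesis using h_prev h_pos[OF vW] oW by simp
    qed (simp add: h_pos)
  next
    fix u :: "int \<Rightarrow> real" and x
    assume uk: "u k = 0" and ue: "\<And>x y. (x, y) \<in> G_edges n k \<Longrightarrow> u x = u y"
      and uL: "\<And>w. w \<in> {1..f} - W \<Longrightarrow> u (k - w) = 0" and x: "0 \<le> x" "x < k"
    have path: "u (pos a 0) = 0" if "0 \<le> a" "a \<le> m" for a
      using that
    proof (induction a rule: int_ge_induct)
      case base thus ?case using uk p0 by simp
    next
      case (step a)
      hence "rho a \<noteq> rho m" using rho_inj[of a m] m_range by auto
      moreover have "valid a 0" using step unfolding valid_def occ_def by auto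
      moreover have "0 \<notin> W" using W by auto
      ultimately have "(pos a 0, pos (a + 1) 0) \<in> G_edges n k" by (intro keep) auto
      from ue[OF this] step show ?case by simp
    qed
    have intact: "u (pos r w) = 0" if w: "w \<in> {1..f} - W" for r w
    proof (rule pos_zero_propagate[of u 0])
      show "u (pos 0 w) = 0" using uL[OF w] pos_0[of w] w f_le_k by simp
      show "u (pos r w) = u (pos (r + 1) w)" for r
        using w by (intro ue keep valid_cycle) auto
    qed
    \<comment> \<open>A spliced cycle is entered at step \<open>s + 1\<close> and traversed up to
      the cut at \<open>s\<close>.\<close>
    have splice: "u (pos r (\<omega> e)) = 0" if e: "0 \<le> e" "e < d" and z: "u (prev e) = 0" for e r
    proof (rule pos_zero_propagate[of u "s + 1"])
      show "u (pos (s + 1) (\<omega> e)) = 0" using ue[OF new[OF e]] z by simp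
      fix r assume r: "(r - (s + 1)) mod q \<noteq> q - 1"
      have "rho r \<noteq> rho s"
      proof
        assume "rho r = rho s"
        hence "(r - (s + 1)) mod q = (s - (s + 1)) mod q"
          unfolding rho_eq_iff by (rule mod_diff_cong) simp
        thus False using r q by (simp add: zmod_minus1)
      qed
      thus "u (pos r (\<omega> e)) = u (pos (r + 1) (\<omega> e))"
        using vW[OF e] oW[OF e] W by (intro ue keep) auto
    qed
    have spliced: "\<forall>r. u (pos r (\<omega> e)) = 0" if "0 \<le> e" "e < d" for e
      using that
    proof (induction e rule: int_ge_induct)
      case base
      have "u (prev 0) = 0" unfolding prev_def using path m_range by simp
      thus ?case using splice base by blast
    next
      case (step e)
      have "u (prev (e + 1)) = 0" unfolding prev_def using step by simp
      thus ?case using splice[of "e + 1"] step by auto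
    qed
    obtain r w where r: "0 \<le> r" "r < q" "valid r w" "x = pos r w"
      using pos_surj[of x] x by auto
    consider "w = 0" | "w \<in> {1..f} - W" | "w \<in> W"
      using r(3) unfolding valid_def by auto
    thus "u x = 0"
    proof cases
      case 1
      hence "r \<le> m" using r unfolding valid_def occ_rho by simp
      thus ?thesis using path r 1 by simp
    next
      case 3
      thus ?thesis using spliced r unfolding W_def by auto
    qed (use intact r in simp)
  qed
qed

text \<open>Edge \<open>i < d\<close> starts at step \<open>s\<close> of cycle \<open>f - i\<close>,
  on the arc after \<open>rho m\<close>. Moving its source back by one attaches its target to cycle
  \<open>f - i + 1\<close>, or to the end of the path if \<open>i = 0\<close>.\<close>

lemma N_eta_up:
  assumes d: "0 \<le> d" "d \<le> f"
  shows "int (N (eta k q j + d) k) = f - d"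
proof -
  obtain s where s: "rho s = (rho m + 1) mod q"
    using rho_surj[of "(rho m + 1) mod q"] q by auto
  define \<omega> where "\<omega> = (\<lambda>e. f - e)"
  have dk: "d \<le> k" using d f_le_k by simp
  have W: "\<omega> ` {0..<d} = {f - d + 1..f}"
    unfolding \<omega>_def by (auto simp: image_iff intro: bexI[of _ "f - _"])
  have src: "pos s (\<omega> e) = (e + eta k q j - 1) mod (k + 1)" for e
    unfolding pos_above_m[OF s] \<omega>_def by (simp add: algebra_simps)
  have vs: "valid r (\<omega> e)" if "0 \<le> e" "e < d" for r e
    using that d unfolding \<omega>_def by (intro valid_cycle) auto
  have ns: "\<not> (\<omega> e = 0 \<and> R)" if "0 \<le> e" "e < d" for e R
    using that d unfolding \<omega>_def by auto
  have tgt: "pos (s + 1) (\<omega> e) = (e + eta k q j) mod k" if e: "0 \<le> e" "e < d" for e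
  proof -
    have "(pos s (\<omega> e), (e + eta k q j) mod k) \<in> G_edges (eta k q j) k"
      unfolding G_edges_iff src using e dk by auto
    from G_edges_functional[OF this edges_eta[OF vs[OF e] ns[OF e]]] show ?thesis by simp
  qed
  have prev: "(if e = 0 then pos m 0 else pos s (\<omega> (e - 1))) = (e + eta k q j - 2) mod (k + 1)" for e
    unfolding pos_m src by (simp add: algebra_simps)
  have "N (eta k q j + d) k = card ({1..f} - \<omega> ` {0..<d})"
  proof (rule N_spliced[where s = s])
    show "\<omega> ` {0..<d} \<subseteq> {1..f}" unfolding W using d by auto
  next
    fix r w assume v: "valid r w" and nD: "\<not> (w = 0 \<and> rho r = rho m)"
      and nW: "\<not> (rho r = rho s \<and> w \<in> \<omega> ` {0..<d})"
    obtain i where i: "0 \<le> i" "i < k" "pos r w = (i + eta k q j - 1) mod (k + 1)"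
      "pos (r + 1) w = (i + eta k q j) mod k" using edge_exists[OF v nD] .
    have "\<not> i < d"
    proof
      assume "i < d"
      hence "pos r w = pos s (\<omega> i)" "valid s (\<omega> i)" using src i vs by auto
      from pos_inj[OF v this(2,1)] show False using nW \<open>i < d\<close> i by auto
    qed
    thus "(pos r w, pos (r + 1) w) \<in> G_edges (eta k q j + d) k"
      unfolding G_edges_shift_up[OF d(1) dk] using i by (intro exI[of _ i]) simp
  next
    fix e assume e: "0 \<le> e" "e < d"
    show "(if e = 0 then pos m 0 else pos s (\<omega> (e - 1)), pos (s + 1) (\<omega> e))
      \<in> G_edges (eta k q j + d) k"
      unfolding G_edges_shift_up[OF d(1) dk] prev tgt[OF e] using e dk by (intro exI[of _ e]) simp
  next
    fix x y assume "(x, y) \<in> G_edges (eta k q j + d) k"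
    then obtain i where i: "0 \<le> i" "i < k" "y = (i + eta k q j) mod k"
      "x = (if i < d then (i + eta k q j - 2) mod (k + 1) else (i + eta k q j - 1) mod (k + 1))"
      unfolding G_edges_shift_up[OF d(1) dk] by auto
    show "(\<exists>r w. valid r w \<and> valid (r + 1) w \<and> x = pos r w \<and> y = pos (r + 1) w) \<or>
      (\<exists>e. 0 \<le> e \<and> e < d \<and> x = (if e = 0 then pos m 0 else pos s (\<omega> (e - 1))) \<and> y = pos (s + 1) (\<omega> e))"
    proof (cases "i < d")
      case True
      thus ?thesis using i unfolding prev by (intro disjI2 exI[of _ i]) (simp add: tgt)
    next
      case False
      hence "(x, y) \<in> G_edges (eta k q j) k" unfolding G_edges_iff using i by auto
      thus ?thesis using edges_eta_cases by metis
    qed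
  qed
  also have "{1..f} - \<omega> ` {0..<d} = {1..f - d}" unfolding W using d by auto
  finally show ?thesis using d by simp
qed

text \<open>On the other side of the sink, edge \<open>k - 1 - e\<close> starts at step
  \<open>m\<close> of cycle \<open>e + 1\<close>. Moving its source forward attaches its target to
  cycle \<open>e\<close>, where \<open>e = 0\<close> is the path.\<close>

lemma N_eta_down:
  assumes d: "0 \<le> d" "d \<le> f"
  shows "int (N (eta k q j - d) k) = f - d"
proof -
  define \<omega> :: "int \<Rightarrow> int" where "\<omega> = (\<lambda>e. e + 1)"
  have dk: "d \<le> k" using d f_le_k by simp
  have W: "\<omega> ` {0..<d} = {1..d}"
    unfolding \<omega>_def by (auto simp: image_iff intro: bexI[of _ "_ - 1"])
  have src: "pos m (\<omega> e) = (k - 1 - e + eta k q j - 1) mod (k + 1)" for e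
    unfolding pos_m \<omega>_def by (rule mod_eqI[where c = "- 1"]) (simp add: algebra_simps)
  have vs: "valid r (\<omega> e)" if "0 \<le> e" "e < d" for r e
    using that d unfolding \<omega>_def by (intro valid_cycle) auto
  have ns: "\<not> (\<omega> e = 0 \<and> R)" if "0 \<le> e" "e < d" for e R
    using that d unfolding \<omega>_def by auto
  have tgt: "pos (m + 1) (\<omega> e) = (k - 1 - e + eta k q j) mod k" if e: "0 \<le> e" "e < d" for e
  proof -
    have "(pos m (\<omega> e), (k - 1 - e + eta k q j) mod k) \<in> G_edges (eta k q j) k"
      unfolding G_edges_iff src using e dk by (intro exI[of _ "k - 1 - e"]) auto
    from G_edges_functional[OF this edges_eta[OF vs[OF e] ns[OF e]]] show ?thesis by simp
  qed
  have prev: "(if e = 0 then pos m 0 else pos m (\<omega> (e - 1))) = (k - 1 - e + eta k q j) mod (k + 1)" for e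
  proof -
    have "(if e = 0 then pos m 0 else pos m (\<omega> (e - 1))) = pos m e" unfolding \<omega>_def by simp
    also have "\<dots> = (k - 1 - e + eta k q j) mod (k + 1)"
      unfolding pos_m by (rule mod_eqI[where c = "- 1"]) (simp add: algebra_simps)
    finally show ?thesis .
  qed
  have "N (eta k q j - d) k = card ({1..f} - \<omega> ` {0..<d})"
  proof (rule N_spliced[where s = m])
    show "\<omega> ` {0..<d} \<subseteq> {1..f}" unfolding W using d by auto
  next
    fix r w assume v: "valid r w" and nD: "\<not> (w = 0 \<and> rho r = rho m)"
      and nW: "\<not> (rho r = rho m \<and> w \<in> \<omega> ` {0..<d})"
    obtain i where i: "0 \<le> i" "i < k" "pos r w = (i + eta k q j - 1) mod (k + 1)"
      "pos (r + 1) w = (i + eta k q j) mod k" using edge_exists[OF v nD] .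
    have "\<not> k - d \<le> i"
    proof
      assume a: "k - d \<le> i"
      define e where "e = k - 1 - i"
      have e: "0 \<le> e" "e < d" using a i unfolding e_def by auto
      have "pos r w = pos m (\<omega> e)" using src[of e] i unfolding e_def by simp
      from pos_inj[OF v vs[OF e] this] show False using nW e by auto
    qed
    thus "(pos r w, pos (r + 1) w) \<in> G_edges (eta k q j - d) k"
      unfolding G_edges_shift_down[OF d(1) dk] using i by (intro exI[of _ i]) simp
  next
    fix e assume e: "0 \<le> e" "e < d"
    show "(if e = 0 then pos m 0 else pos m (\<omega> (e - 1)), pos (m + 1) (\<omega> e))
      \<in> G_edges (eta k q j - d) k"
      unfolding G_edges_shift_down[OF d(1) dk] prev tgt[OF e] using e dk
      by (intro exI[of _ "k - 1 - e"]) simp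
  next
    fix x y assume "(x, y) \<in> G_edges (eta k q j - d) k"
    then obtain i where i: "0 \<le> i" "i < k" "y = (i + eta k q j) mod k"
      "x = (if k - d \<le> i then (i + eta k q j) mod (k + 1) else (i + eta k q j - 1) mod (k + 1))"
      unfolding G_edges_shift_down[OF d(1) dk] by auto
    show "(\<exists>r w. valid r w \<and> valid (r + 1) w \<and> x = pos r w \<and> y = pos (r + 1) w) \<or>
      (\<exists>e. 0 \<le> e \<and> e < d \<and> x = (if e = 0 then pos m 0 else pos m (\<omega> (e - 1))) \<and> y = pos (m + 1) (\<omega> e))"
    proof (cases "k - d \<le> i")
      case True
      thus ?thesis using i unfolding prev by (intro disjI2 exI[of _ "k - 1 - i"]) (simp add: tgt)
    next
      case False
      hence "(x, y) \<in> G_edges (eta k q j) k" unfolding G_edges_iff using i by auto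
      thus ?thesis using edges_eta_cases by metis
    qed
  qed
  also have "{1..f} - \<omega> ` {0..<d} = {d + 1..f}" unfolding W using d by auto
  finally show ?thesis using d by simp
qed

lemma N_eta:
  assumes "\<bar>d\<bar> \<le> f"
  shows "int (N (eta k q j + d) k) = f - \<bar>d\<bar>"
proof (cases "0 \<le> d")
  case True thus ?thesis using N_eta_up[of d] assms by simp
next
  case False thus ?thesis using N_eta_down[of "- d"] assms by simp
qed

section \<open>The explicit cycles and the range of the peaks\<close>

lemma c_fun_eq_pos:
  assumes "0 \<le> r" "r \<le> q" "1 \<le> w" "w \<le> f"
  shows "c_fun k q j w r = pos r w"
proof (cases "r = 0 \<or> r = q")
  case True
  hence "pos r w = pos 0 w" by (intro pos_cong) auto
  thus ?thesis using True pos_0[of w] assms f_le_k unfolding c_fun_def by simp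
next
  case False
  have "rho r \<noteq> rho 0" using rho_inj[of r 0] False assms by auto
  hence r0: "rho r > 0" using rho_range[of r] rho_0 by simp
  have "t_fun k r q j = cnt (rho r)"
    unfolding t_fun_def cnt_def rho_def[symmetric] by (simp add: Int_def)
  thus ?thesis using pos_pos(1)[OF valid_cycle r0] False assms
    unfolding c_fun_def F_def rho_def[symmetric] by simp
qed

lemma c_fun_is_cycle:
  assumes w: "1 \<le> w" "w \<le> f"
  shows "is_cycle (G_edges (eta k q j) k) (c_fun k q j w) q"
  unfolding is_cycle_def
proof (intro conjI ballI)
  fix r assume "r \<in> {0..<q}"
  thus "(c_fun k q j w r, c_fun k q j w (r + 1)) \<in> G_edges (eta k q j) k"
    using w edges_eta[OF valid_cycle[OF w]] by (simp add: c_fun_eq_pos)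
next
  show "inj_on (c_fun k q j w) {0..<q}"
  proof (rule inj_onI)
    fix r r' assume r: "r \<in> {0..<q}" "r' \<in> {0..<q}" "c_fun k q j w r = c_fun k q j w r'"
    hence "pos r w = pos r' w" using w by (simp add: c_fun_eq_pos)
    from pos_inj(1)[OF valid_cycle[OF w] valid_cycle[OF w] this]
    show "r = r'" using rho_inj r by simp
  qed
qed (use q in \<open>auto simp: c_fun_def\<close>)

lemma cycle_verts_distinct:
  assumes w: "1 \<le> w" "w \<le> f" "1 \<le> w'" "w' \<le> f" "w \<noteq> w'"
  shows "cycle_verts (c_fun k q j w) q \<noteq> cycle_verts (c_fun k q j w') q"
proof
  assume eq: "cycle_verts (c_fun k q j w) q = cycle_verts (c_fun k q j w') q"
  have "c_fun k q j w 0 \<in> cycle_verts (c_fun k q j w) q"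
    unfolding cycle_verts_def using q by auto
  hence "c_fun k q j w 0 \<in> c_fun k q j w' ` {0..<q}"
    unfolding eq by (simp add: cycle_verts_def)
  then obtain r where "0 \<le> r" "r < q" "c_fun k q j w 0 = c_fun k q j w' r" by auto
  hence "pos 0 w = pos r w'" using c_fun_eq_pos[of 0 w] c_fun_eq_pos[of r w'] w q by simp
  thus False using pos_inj(2)[OF valid_cycle[OF w(1,2)] valid_cycle[OF w(3,4)]] w(5) by blast
qed

text \<open>The remainder \<open>b\<close> in \<open>eta_residue\<close> lies in
  \<open>[0, k)\<close>, which gives the quotient and the upper bound. Positivity comes from
  \<open>eta_eq\<close> with \<open>z \<ge> 1\<close>.\<close>

lemma eta_div: "eta k q j div k = ((k + 1) * j) div q - 1"
  and eta_bounds: "0 < eta k q j" "eta k q j < k\<^sup>2 + k"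
proof -
  define b where "b = F (rho (m + 1)) - of_bool (rho (m + 1) > 0)"
  have b: "0 \<le> b \<and> b < k"
  proof (cases "rho (m + 1) > 0")
    case True
    have "F 0 + f \<le> F (rho (m + 1))" "F (rho (m + 1)) + f \<le> F q"
      using F_less_weak True rho_range[of "m + 1"] by auto
    thus ?thesis using True f_pos F_0 F_q unfolding b_def by simp
  next
    case False
    hence "rho (m + 1) = 0" using rho_range[of "m + 1"] by simp
    thus ?thesis using F_0 q unfolding b_def by simp
  qed
  have e: "eta k q j = b + k * (((k + 1) * j) div q - 1)"
    unfolding eta_residue b_def by simp
  thus "eta k q j div k = ((k + 1) * j) div q - 1" using b by simp
  have "(k + 1) * j \<le> (k + 1) * q" using j q by (intro mult_left_mono) auto
  hence "((k + 1) * j) div q \<le> ((k + 1) * q) div q" using q by (intro zdiv_mono1) auto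
  hence "((k + 1) * j) div q - 1 \<le> k" using q by simp
  hence "k * (((k + 1) * j) div q - 1) \<le> k * k" using q by (intro mult_left_mono) auto
  thus "eta k q j < k\<^sup>2 + k" using b unfolding e power2_eq_square by linarith
  define z where "z = f * j + (m * j) div q"
  have "z \<ge> 1"
  proof -
    have "f * j \<ge> 1 * 1" using f_pos j by (intro mult_mono) auto
    moreover have "(m * j) div q \<ge> 0" using m_range j q by (simp add: pos_imp_zdiv_nonneg_iff)
    ultimately show ?thesis unfolding z_def by simp
  qed
  define p where "p = (k + 1) * z"
  have "p \<ge> (k + 1) * 1" unfolding p_def using \<open>z \<ge> 1\<close> q by (intro mult_left_mono) auto
  moreover have "F (rho m) \<ge> 0" using F_mono[of 0 "rho m"] F_0 rho_range[of m] by simp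
  ultimately show "0 < eta k q j" unfolding eta_eq z_def[symmetric] p_def[symmetric] by simp
qed

lemma local_peak_eta: "local_peak (eta k q j) k"
  unfolding local_peak_def
  using eta_bounds N_eta[of 0] N_eta[of 1] N_eta[of "- 1"] f_pos by simp

lemma N_slope:
  assumes "- f \<le> d" "d < f"
  shows "N (eta k q j + d) k < N (eta k q j + d + 1) k \<longleftrightarrow> d < 0"
proof -
  have "int (N (eta k q j + d) k) = f - \<bar>d\<bar>" using assms by (intro N_eta) auto
  moreover have "int (N (eta k q j + d + 1) k) = f - \<bar>d + 1\<bar>"
    unfolding add.assoc using assms by (intro N_eta) auto
  ultimately show ?thesis by linarith
qed

end

section \<open>The mountains tile a period\<close>

text \<open>Cycles of a functional relation with a common start agree step by step, so the longer
  one would return to its start too early.\<close>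

lemma cycle_length_unique:
  assumes c: "is_cycle E c l" "is_cycle E c' l'" and eq: "c 0 = c' 0"
    and func: "\<And>x y y'. (x, y) \<in> E \<Longrightarrow> (x, y') \<in> E \<Longrightarrow> y = y'"
  shows "l = l'"
proof -
  have *: "\<not> l < l'" if c: "is_cycle E c l" "is_cycle E c' l'" and eq: "c 0 = c' 0" for c c' l l'
  proof
    assume l: "l < l'"
    have "c r = c' r" if "0 \<le> r" "r \<le> l" for r
      using that
    proof (induction r rule: int_ge_induct)
      case (step r)
      have "(c r, c (r + 1)) \<in> E" using c(1) step(1,3) unfolding is_cycle_def by auto
      moreover have "(c' r, c' (r + 1)) \<in> E" using c(2) step(1,3) l unfolding is_cycle_def by auto
      moreover have "c r = c' r" using step by simp
      ultimately show ?case using func by simp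
    qed (rule eq)
    from this[of l] have "c' l = c' 0" using c eq unfolding is_cycle_def by simp
    moreover have "inj_on c' {0..<l'}" "l \<ge> 1" using c unfolding is_cycle_def by auto
    ultimately have "l = 0" using l by (auto dest: inj_onD)
    thus False using \<open>l \<ge> 1\<close> by simp
  qed
  show ?thesis using *[OF c eq] *[OF c(2,1) eq[symmetric]] by simp
qed

text \<open>The graph determines \<open>q\<close> as the length of the cycle through
  \<open>k - 1\<close>. Then \<open>j\<close> is recovered from the quotient of \<open>eta\<close>
  by \<open>k\<close>, which strictly increases with \<open>j\<close> because
  \<open>q < k + 1\<close>.\<close>

lemma eta_inj:
  assumes "farey_index k q j" "farey_index k q' j'" and eq: "eta k q j = eta k q' j'"
  shows "q = q' \<and> j = j'"
proof -
  interpret A: farey_index k q j by fact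
  interpret B: farey_index k q' j' by fact
  have "c_fun k q j 1 0 = c_fun k q' j' 1 0" unfolding c_fun_def by simp
  moreover have "is_cycle (G_edges (eta k q j) k) (c_fun k q j 1) q"
    by (rule A.c_fun_is_cycle[OF order_refl A.f_pos])
  moreover have "is_cycle (G_edges (eta k q j) k) (c_fun k q' j' 1) q'"
    unfolding eq by (rule B.c_fun_is_cycle[OF order_refl B.f_pos])
  ultimately have qq: "q = q'" using cycle_length_unique G_edges_functional by metis
  have *: "((k + 1) * i) div q < ((k + 1) * i') div q" if "i < i'" for i i'
  proof -
    have "(k + 1) * (i + 1) \<le> (k + 1) * i'" using that A.q by (intro mult_left_mono) auto
    hence "(k + 1) * i + q \<le> (k + 1) * i'" using A.q by (simp add: algebra_simps)
    hence "((k + 1) * i + q) div q \<le> ((k + 1) * i') div q" using A.q by (intro zdiv_mono1) auto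
    thus ?thesis using A.q by simp
  qed
  have "((k + 1) * j) div q = ((k + 1) * j') div q" using A.eta_div B.eta_div eq qq by simp
  hence "j = j'" using *[of j j'] *[of j' j] by (cases j j' rule: linorder_cases) auto
  with qq show ?thesis by simp
qed

lemma N_shift_cong:
  assumes "n mod (k\<^sup>2 + k) = n' mod (k\<^sup>2 + k)"
  shows "N (n + c) k = N (n' + c) k"
proof -
  have "(n + c) mod (k\<^sup>2 + k) = (n' + c) mod (k\<^sup>2 + k)" using assms by (rule mod_add_cong) simp
  thus ?thesis unfolding N_def by simp
qed

text \<open>An offset \<open>d\<close> stands for the step from \<open>d\<close> to
  \<open>d + 1\<close>, which ascends exactly when \<open>d < 0\<close>. If the offsets differed, a
  translation \<open>c\<close> within both ranges would make exactly one of them negative, so the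
  same step would both ascend and not ascend.\<close>

lemma mountain_offset_not_less:
  assumes "farey_index k q j" "farey_index k q' j'"
    and d: "- fq k q \<le> d" "d < fq k q" and d': "- fq k q' \<le> d'" "d' < fq k q'"
    and eq: "(eta k q j + d) mod (k\<^sup>2 + k) = (eta k q' j' + d') mod (k\<^sup>2 + k)"
  shows "\<not> d < d'"
proof
  assume less: "d < d'"
  interpret A: farey_index k q j by fact
  interpret B: farey_index k q' j' by fact
  have slope: "d + c < 0 \<longleftrightarrow> d' + c < 0"
    if "- fq k q \<le> d + c" "d + c < fq k q" "- fq k q' \<le> d' + c" "d' + c < fq k q'" for c
    using A.N_slope[OF that(1,2)] B.N_slope[OF that(3,4)]
      N_shift_cong[OF eq, of c] N_shift_cong[OF eq, of "c + 1"] by (simp add: add.assoc)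
  consider "d < 0" "0 \<le> d'" | "d' < 0" | "0 \<le> d" using less by linarith
  thus False
  proof cases
    case 1
    thus ?thesis using slope[of 0] d d' by simp
  next
    case 2
    thus ?thesis using slope[of "- d'"] d d' less A.f_pos B.f_pos by simp
  next
    case 3
    thus ?thesis using slope[of "- d - 1"] d d' less A.f_pos B.f_pos by simp
  qed
qed

lemma mountains_disjoint:
  assumes fi: "farey_index k q j" "farey_index k q' j'"
    and d: "- fq k q \<le> d" "d < fq k q" and d': "- fq k q' \<le> d'" "d' < fq k q'"
    and eq: "(eta k q j + d) mod (k\<^sup>2 + k) = (eta k q' j' + d') mod (k\<^sup>2 + k)"
  shows "q = q' \<and> j = j' \<and> d = d'"
proof -
  interpret A: farey_index k q j by fact
  interpret B: farey_index k q' j' by fact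
  have dd: "d = d'"
    using mountain_offset_not_less[OF fi d d' eq] mountain_offset_not_less[OF fi(2,1) d' d eq[symmetric]]
    by simp
  have "(eta k q j + d - d) mod (k\<^sup>2 + k) = (eta k q' j' + d' - d) mod (k\<^sup>2 + k)"
    using eq by (rule mod_diff_cong) simp
  hence "eta k q j = eta k q' j'"
    using dd A.eta_bounds B.eta_bounds by simp
  from eta_inj[OF fi this] dd show ?thesis by simp
qed

lemma card_triangle:
  fixes k :: int
  assumes "k \<ge> 0"
  shows "int (card (SIGMA y:{1..k}. {1..y} \<times> (UNIV :: bool set))) = k\<^sup>2 + k"
proof -
  have "int (card (SIGMA y:{1..k}. {1..y} \<times> (UNIV :: bool set))) = (\<Sum>y\<in>{1..k}. y * 2)"
    by (subst card_SigmaI) (auto simp: card_cartesian_product intro!: sum.cong)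
  also have "\<dots> = k\<^sup>2 + k"
    using assms
  proof (induction k rule: int_ge_induct)
    case (step k)
    have "{1..k + 1} = insert (k + 1) {1..k}" using step by auto
    thus ?case using step by (simp add: power2_eq_square algebra_simps)
  qed simp
  finally show ?thesis .
qed

text \<open>The mountains cover the whole period, by counting: writing a pair \<open>x \<le> y\<close> as \<open>g\<close> times
  a coprime pair \<open>(j, q)\<close> parametrises the offsets \<open>g - 1\<close> and \<open>- g\<close> around \<open>eta k q j\<close>,
  and there are \<open>(k\<^sup>2 + k) / 2\<close> such pairs.\<close>
lemma mountains_cover:
  fixes k n :: int
  assumes k: "k \<ge> 1" and n: "0 \<le> n" "n < k\<^sup>2 + k"
  obtains q j d where "farey_index k q j" "- fq k q \<le> d" "d < fq k q"
    "n = (eta k q j + d) mod (k\<^sup>2 + k)"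
proof -
  define S where "S = (SIGMA y:{1..k}. {1..y} \<times> (UNIV :: bool set))"
  define off :: "int \<Rightarrow> bool \<Rightarrow> int" where "off = (\<lambda>g b. if b then g - 1 else - g)"
  define \<Phi> where "\<Phi> = (\<lambda>(y, x, b). (eta k (y div gcd x y) (x div gcd x y) + off (gcd x y) b) mod (k\<^sup>2 + k))"
  have K: "k\<^sup>2 + k > 0" using k by (simp add: add_nonneg_pos)
  have param: "farey_index k (y div gcd x y) (x div gcd x y) \<and>
      - fq k (y div gcd x y) \<le> off (gcd x y) b \<and> off (gcd x y) b < fq k (y div gcd x y)"
    if "(y, x, b) \<in> S" for x y b
  proof -
    have xy: "1 \<le> x" "x \<le> y" "y \<le> k" using that unfolding S_def by auto
    define g where "g = gcd x y"
    have g: "g \<ge> 1" using xy unfolding g_def by (simp add: int_one_le_iff_zero_less)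
    have gx: "x div g * g = x" "y div g * g = y" unfolding g_def by simp_all
    have pos: "1 \<le> x div g" "1 \<le> y div g" using xy gx g
      by (smt (verit) mult_nonpos_nonneg)+
    have le: "x div g \<le> y div g" using xy g by (intro zdiv_mono1) auto
    have yk: "y div g \<le> k" using mult_left_mono[of 1 g "y div g"] pos gx g xy by simp
    have cop: "coprime (x div g) (y div g)"
      unfolding g_def using xy by (intro div_gcd_coprime) auto
    \<comment> \<open>The height of the mountain is at least \<open>g\<close>, since
      \<open>g\<close> times the reduced denominator is \<open>y \<le> k\<close>.\<close>
    have "y div g * g div (y div g) \<le> k div (y div g)"
      using xy pos gx by (intro zdiv_mono1) auto
    hence "g \<le> fq k (y div g)" unfolding fq_def using pos by simp
    thus ?thesis using pos le yk cop g unfolding g_def[symmetric] off_def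
      by (auto intro!: farey_index.intro)
  qed
  have inj: "inj_on \<Phi> S"
  proof (rule inj_onI)
    fix p p' assume "p \<in> S" "p' \<in> S" "\<Phi> p = \<Phi> p'"
    moreover obtain y x b where p: "p = (y, x, b)" by (cases p)
    moreover obtain y' x' b' where p': "p' = (y', x', b')" by (cases p')
    ultimately have S: "(y, x, b) \<in> S" "(y', x', b') \<in> S" and eq: "\<Phi> (y, x, b) = \<Phi> (y', x', b')"
      by simp_all
    define g g' where "g = gcd x y" and "g' = gcd x' y'"
    have "y div g = y' div g' \<and> x div g = x' div g' \<and> off g b = off g' b'"
      unfolding g_def g'_def using param[OF S(1)] param[OF S(2)] eq unfolding \<Phi>_def
      by (intro mountains_disjoint) auto
    moreover have "g \<ge> 1" "g' \<ge> 1"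
      using S unfolding S_def g_def g'_def by (auto simp: int_one_le_iff_zero_less)
    moreover have "y = y div g * g" "x = x div g * g" "y' = y' div g' * g'" "x' = x' div g' * g'"
      unfolding g_def g'_def by simp_all
    ultimately have "g = g' \<and> b = b' \<and> y = y' \<and> x = x'"
      unfolding off_def by (auto split: if_splits)
    thus "p = p'" using p p' by simp
  qed
  have sub: "\<Phi> ` S \<subseteq> {0..<k\<^sup>2 + k}" using K unfolding \<Phi>_def by auto
  \<comment> \<open>As many distinct residues as the period has elements, so every residue is
    hit.\<close>
  have "int (card (\<Phi> ` S)) = k\<^sup>2 + k"
    using card_image[OF inj] card_triangle[of k] k unfolding S_def by simp
  hence "card (\<Phi> ` S) = card {0..<k\<^sup>2 + k}" using K by simp
  hence "\<Phi> ` S = {0..<k\<^sup>2 + k}" using sub by (intro card_subset_eq) auto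
  hence "n \<in> \<Phi> ` S" using n by simp
  then obtain y x b where "(y, x, b) \<in> S" "n = \<Phi> (y, x, b)" by auto
  thus ?thesis using that[of "y div gcd x y" "x div gcd x y" "off (gcd x y) b"] param[of y x b]
    unfolding \<Phi>_def by simp
qed

text \<open>Every \<open>n\<close> lies on some mountain, and off the summit the neighbour towards
  the summit is not lower.\<close>

lemma local_peak_imp_eta:
  assumes k: "k \<ge> 1" and peak: "local_peak n k"
  obtains q j where "farey_index k q j" "n = eta k q j"
proof -
  have n: "0 < n" "n < k\<^sup>2 + k" "N (n - 1) k < N n k" "N (n + 1) k < N n k"
    using peak unfolding local_peak_def by auto
  obtain q j d where fi: "farey_index k q j" and d: "- fq k q \<le> d" "d < fq k q"
    and nd: "n = (eta k q j + d) mod (k\<^sup>2 + k)"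
    using mountains_cover[OF k, of n] n by auto
  interpret farey_index k q j by fact
  have cong: "N (n + c) k = N (eta k q j + d + c) k" for c
    by (rule N_shift_cong) (simp add: nd)
  have "d = 0"
  proof (rule linorder_cases[of d 0])
    assume "d < 0"
    thus ?thesis using N_slope[OF d] cong[of 0] cong[of 1] n by simp
  next
    assume "d > 0"
    thus ?thesis using N_slope[of "d - 1"] d f_pos cong[of 0] cong[of "- 1"] n by (simp add: add_diff_eq)
  qed
  hence "n = eta k q j" using nd eta_bounds by simp
  thus ?thesis using that fi by blast
qed

lemma farey_index_iff:
  "farey_index k q j \<longleftrightarrow> 1 \<le> q \<and> q \<le> k \<and> 1 \<le> j \<and> j \<le> q \<and> gcd j q = 1"
  unfolding farey_index_def coprime_iff_gcd_eq_1 by auto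

theorem theorem7p5:
  fixes k :: int
  assumes "k \<ge> 1"
  shows "(\<forall>q j. 1 \<le> q \<and> q \<le> k \<and> 1 \<le> j \<and> j \<le> q \<and> gcd j q = 1 \<longrightarrow>
            (\<forall>w \<in> {1..fq k q}. is_cycle (G_edges (eta k q j) k) (c_fun k q j w) q) \<and>
            (\<forall>w \<in> {1..fq k q}. \<forall>w' \<in> {1..fq k q}. w \<noteq> w' \<longrightarrow>
               cycle_verts (c_fun k q j w) q \<noteq> cycle_verts (c_fun k q j w') q) \<and>
            int (N (eta k q j) k) = fq k q \<and>
            local_peak (eta k q j) k)
       \<and> {n. local_peak n k} =
           {eta k q j | q j. 1 \<le> q \<and> q \<le> k \<and> 1 \<le> j \<and> j \<le> q \<and> gcd j q = 1}
       \<and> {(n, int (N n k)) | n. local_peak n k} =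
           {(eta k q j, k div q) | q j. 1 \<le> q \<and> q \<le> k \<and> 1 \<le> j \<and> j \<le> q \<and> gcd j q = 1}"
proof -
  have N_peak: "int (N (eta k q j) k) = k div q" if "farey_index k q j" for q j
    using farey_index.N_eta[OF that, of 0] farey_index.f_pos[OF that] by (simp add: fq_def)
  have peaks: "local_peak n k \<longleftrightarrow> (\<exists>q j. farey_index k q j \<and> n = eta k q j)" for n
    using local_peak_imp_eta[OF assms] farey_index.local_peak_eta by metis
  have "(\<forall>w \<in> {1..fq k q}. is_cycle (G_edges (eta k q j) k) (c_fun k q j w) q) \<and>
      (\<forall>w \<in> {1..fq k q}. \<forall>w' \<in> {1..fq k q}. w \<noteq> w' \<longrightarrow>
         cycle_verts (c_fun k q j w) q \<noteq> cycle_verts (c_fun k q j w') q) \<and>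
      int (N (eta k q j) k) = fq k q \<and> local_peak (eta k q j) k" if "farey_index k q j" for q j
    using farey_index.c_fun_is_cycle[OF that] farey_index.cycle_verts_distinct[OF that]
      N_peak[OF that] farey_index.local_peak_eta[OF that] by (auto simp: fq_def)
  moreover have "{n. local_peak n k} = {eta k q j | q j. farey_index k q j}"
    unfolding peaks by auto
  moreover have "{(n, int (N n k)) | n. local_peak n k} = {(eta k q j, k div q) | q j. farey_index k q j}"
    unfolding peaks using N_peak by (auto, blast)
  ultimately show ?thesis unfolding farey_index_iff by blast
qed

end
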